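(* For $n\ge1$ let $\alpha_n=2^{-n}$, $r_n=1-\frac1n2^{-2n}$, $z_n=r_ne^{i\alpha_n}$, and let $\vartheta$ be the Blaschke product $$\vartheta(z)=\prod_{n=1}^\infty\frac{-\overline{z_n}}{|z_n|}\,\frac{z-z_n}{1-\overline{z_n}z},\qquad z\in\mathbb{D}.$$ Let $\varphi(z)=(1+z)/2$. Then $$\int_{\mathbb{D}}\left(\frac{1-|\vartheta(z)|^2}{1-|z|^2}\right)^3N_\varphi(z)\,dA(z)<\infty,$$ but the composition operator $C_\varphi:K_\vartheta\to H^2(\mathbb{D})$, $C_\varphi f=f\circ\varphi$, is not a Hilbert–Schmidt operator.
   Context: $\mathbb{D}$ is the open unit disk, $H^2(\mathbb{D})$ the Hardy space, $A$ normalized area measure on $\mathbb{D}$. The model space is $K_\vartheta=H^2(\mathbb{D})\ominus\vartheta H^2(\mathbb{D})$. The Nevanlinna counting function is $N_\varphi(z)=\sum_{\varphi(\zeta)=z}\log\frac1{|\zeta|}$, the sum being over preimages $\zeta\in\mathbb{D}$ of $z$ ($N_\varphi(z)=0$ if there are none). *)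

theory Defs
  imports "HOL-Complex_Analysis.Complex_Analysis"
begin

abbreviation unit_disk :: "complex set" where
  "unit_disk \<equiv> ball 0 1"

definition taylor_coeff :: "(complex \<Rightarrow> complex) \<Rightarrow> nat \<Rightarrow> complex" where
  "taylor_coeff f n = (deriv ^^ n) f 0 / fact n"

text \<open>
  Elements of the Hardy space are represented by total functions of which only the values on the
  open unit disk matter: every notion below is insensitive to the values outside the disk, and
  functions agreeing on the disk stand for the same element.
\<close>

definition hardy2 :: "(complex \<Rightarrow> complex) set" where
  "hardy2 = {f. f holomorphic_on unit_disk \<and> summable (\<lambda>n. (cmod (taylor_coeff f n))\<^sup>2)}"

definition h2_inner :: "(complex \<Rightarrow> complex) \<Rightarrow> (complex \<Rightarrow> complex) \<Rightarrow> complex" where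
  "h2_inner f g = (\<Sum>n. taylor_coeff f n * cnj (taylor_coeff g n))"

definition h2_norm :: "(complex \<Rightarrow> complex) \<Rightarrow> real" where
  "h2_norm f = sqrt (Re (h2_inner f f))"

definition model_space :: "(complex \<Rightarrow> complex) \<Rightarrow> (complex \<Rightarrow> complex) set" where
  "model_space \<theta> = {f \<in> hardy2. \<forall>h\<in>hardy2. h2_inner f (\<lambda>z. \<theta> z * h z) = 0}"

definition orthonormal_basis_of ::
    "(complex \<Rightarrow> complex) set \<Rightarrow> (complex \<Rightarrow> complex) set \<Rightarrow> bool" where
  "orthonormal_basis_of V E \<longleftrightarrow>
     E \<subseteq> V \<and>
     (\<forall>e\<in>E. \<forall>e'\<in>E. h2_inner e e' = (if e = e' then 1 else 0)) \<and>
     (\<forall>f\<in>V. \<forall>\<epsilon>>0. \<exists>F c. finite F \<and> F \<subseteq> E \<and>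
        h2_norm (\<lambda>z. f z - (\<Sum>e\<in>F. c e * e z)) < \<epsilon>)"

definition bounded_h2_operator ::
    "(complex \<Rightarrow> complex) set \<Rightarrow> ((complex \<Rightarrow> complex) \<Rightarrow> (complex \<Rightarrow> complex)) \<Rightarrow> bool" where
  "bounded_h2_operator V T \<longleftrightarrow>
     (\<forall>f\<in>V. T f \<in> hardy2) \<and>
     (\<forall>f\<in>V. \<forall>g\<in>V. \<forall>a b. \<forall>z\<in>unit_disk.
        T (\<lambda>w. a * f w + b * g w) z = a * T f z + b * T g z) \<and>
     (\<exists>C. \<forall>f\<in>V. h2_norm (T f) \<le> C * h2_norm f)"

definition hilbert_schmidt_h2 ::
    "(complex \<Rightarrow> complex) set \<Rightarrow> ((complex \<Rightarrow> complex) \<Rightarrow> (complex \<Rightarrow> complex)) \<Rightarrow> bool" where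
  "hilbert_schmidt_h2 V T \<longleftrightarrow>
     bounded_h2_operator V T \<and>
     (\<exists>E. orthonormal_basis_of V E \<and> (\<lambda>e. (h2_norm (T e))\<^sup>2) summable_on E)"

definition composition_op ::
    "(complex \<Rightarrow> complex) \<Rightarrow> (complex \<Rightarrow> complex) \<Rightarrow> (complex \<Rightarrow> complex)" where
  "composition_op \<phi> f = f \<circ> \<phi>"

text \<open>
  The case distinction gives a preimage at the origin its value \<open>log (1/0) = \<infinity>\<close>, since
  \<open>ln (1 / 0) = 0\<close> in HOL. Preimages are summed without multiplicity, which makes no
  difference for univalent \<open>\<phi>\<close>.
\<close>

definition nevanlinna_counting :: "(complex \<Rightarrow> complex) \<Rightarrow> complex \<Rightarrow> ennreal" where
  "nevanlinna_counting \<phi> w =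
     (\<Sum>\<^sub>\<infinity>\<zeta>\<in>{\<zeta>\<in>unit_disk. \<phi> \<zeta> = w}.
        if \<zeta> = 0 then \<infinity> else ennreal (ln (1 / cmod \<zeta>)))"

definition area_measure :: "complex measure" where
  "area_measure = uniform_measure lborel unit_disk"

definition blaschke_factor :: "complex \<Rightarrow> complex \<Rightarrow> complex" where
  "blaschke_factor a z = (- cnj a / of_real (cmod a)) * ((z - a) / (1 - cnj a * z))"

end

theory Submission
  imports Defs
begin

text \<open>
  Write \<open>z\<^sub>n\<close> for the zeros and \<open>k\<^sub>n\<close> for the normalised reproducing kernels at these points.
  The map \<open>z \<mapsto> (1 + z) / 2\<close> sends the unit disk to a disk that touches the unit circle at \<open>1\<close>.
  In the direction of \<open>z\<^sub>n\<close> this image keeps a distance of order \<open>4 ^ -n\<close> from the circle,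
  while \<open>z\<^sub>n\<close> is closer to the circle by the factor \<open>1 / n\<close>, and the zeros are so sparse that
  they hardly interact. Hence the square of the Hilbert--Schmidt norm, which depends linearly
  on the kernel \<open>(1 - |\<theta>|\<^sup>2) / (1 - |z|\<^sup>2)\<close> of the model space, is at least of the order of the
  harmonic series, whereas the cube of that kernel contributes \<open>\<Sum>n. 1 / n ^ 3\<close>.

  Failure of the Hilbert--Schmidt property: each \<open>k\<^sub>n\<close> lies in the model space, and its image
  has squared norm \<open>(1 - |z\<^sub>n|\<^sup>2) / (1 - Re z\<^sub>n)\<close>, comparable to \<open>1 / n\<close>
  (\<open>szego_compose_half_norm\<close>). The Gram matrix of the \<open>k\<^sub>n\<close> decays geometrically off the
  diagonal, so they form a Bessel sequence (\<open>szego_bl_zero_row\<close>, \<open>gram_bessel\<close>), and on such a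
  sequence a Hilbert--Schmidt operator has square-summable images (\<open>hilbert_schmidt_bessel\<close>).
  Boundedness is Schur's test for the matrix of the operator in the monomial basis
  (\<open>hardy2_compose_half\<close>).

  Convergence of the integral: the defect \<open>1 - |\<theta>|\<^sup>2\<close> of the product is at most the sum of the
  defects of its factors (\<open>one_minus_theta_square_le\<close>), so the kernel of the model space is
  bounded by a sum of one term per zero. Disjoint strips around the zeros separate, at each
  point, at most one large term from a background of order \<open>(1 - Re z) ^ (-1/2)\<close>
  (\<open>kernel_quotient_le\<close>). Away from its pole at \<open>1 / 2\<close> the counting function is of order \<open>1 -
  Re z\<close> at most (\<open>ln_near_boundary_le\<close>). Multiplied by it, the cube of the background is
  integrable, and the strip of index \<open>n\<close> contributes at most a constant times \<open>1 / n ^ 3\<close>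
  (\<open>near_majorant_integral_le\<close>).
\<close>

section \<open>The Hardy space as a space of square-summable power series\<close>

lemma taylor_sums:
  assumes "f holomorphic_on unit_disk" "cmod z < 1"
  shows "(\<lambda>n. taylor_coeff f n * z ^ n) sums f z"
  using holomorphic_power_series[of f 0 1 z] assms by (simp add: taylor_coeff_def)

lemma taylor_coeff_unique:
  assumes "\<And>z. cmod z < 1 \<Longrightarrow> (\<lambda>n. c n * z ^ n) sums f z"
  shows "taylor_coeff f n = c n"
proof -
  have "eventually (\<lambda>z. z \<in> ball 0 1) (nhds (0::complex))"
    by (intro eventually_nhds_in_open) auto
  then have "f has_fps_expansion Abs_fps c"
    by (intro has_fps_expansionI) (auto elim!: eventually_mono intro: assms)
  from fps_nth_fps_expansion[OF this, of n] show ?thesis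
    by (simp add: taylor_coeff_def)
qed

lemma taylor_coeff_sum:
  assumes "finite I" "\<And>i. i \<in> I \<Longrightarrow> f i holomorphic_on unit_disk"
  shows "taylor_coeff (\<lambda>z. \<Sum>i\<in>I. c i * f i z) n = (\<Sum>i\<in>I. c i * taylor_coeff (f i) n)"
proof (rule taylor_coeff_unique)
  fix z :: complex assume z: "cmod z < 1"
  have "(\<lambda>n. \<Sum>i\<in>I. c i * (taylor_coeff (f i) n * z ^ n)) sums (\<Sum>i\<in>I. c i * f i z)"
    by (intro sums_sum sums_mult taylor_sums assms z)
  then show "(\<lambda>n. (\<Sum>i\<in>I. c i * taylor_coeff (f i) n) * z ^ n) sums (\<Sum>i\<in>I. c i * f i z)"
    by (simp add: sum_distrib_right mult.assoc)
qed

lemma taylor_coeff_diff: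
  assumes "f holomorphic_on unit_disk" "g holomorphic_on unit_disk"
  shows "taylor_coeff (\<lambda>z. f z - g z) n = taylor_coeff f n - taylor_coeff g n"
proof (rule taylor_coeff_unique)
  fix z :: complex assume z: "cmod z < 1"
  show "(\<lambda>n. (taylor_coeff f n - taylor_coeff g n) * z ^ n) sums (f z - g z)"
    using sums_diff[OF taylor_sums[OF assms(1) z] taylor_sums[OF assms(2) z]]
    by (simp add: left_diff_distrib)
qed

lemma hardy2_holomorphic: "f \<in> hardy2 \<Longrightarrow> f holomorphic_on unit_disk"
  by (simp add: hardy2_def)

lemma hardy2_summable: "f \<in> hardy2 \<Longrightarrow> summable (\<lambda>n. (cmod (taylor_coeff f n))\<^sup>2)"
  by (simp add: hardy2_def)

lemma model_space_hardy2: "f \<in> model_space \<theta> \<Longrightarrow> f \<in> hardy2"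
  by (simp add: model_space_def)

lemma norm_add_square_le:
  fixes x y :: "'a::real_normed_vector"
  shows "(norm (x + y))\<^sup>2 \<le> 2 * (norm x)\<^sup>2 + 2 * (norm y)\<^sup>2"
proof -
  have "(norm (x + y))\<^sup>2 \<le> (norm x + norm y)\<^sup>2"
    by (intro power_mono norm_triangle_ineq) auto
  also have "\<dots> \<le> 2 * (norm x)\<^sup>2 + 2 * (norm y)\<^sup>2"
    using zero_le_power2[of "norm x - norm y"] by (simp add: power2_eq_square algebra_simps)
  finally show ?thesis .
qed

lemma summable_norm_square_sum:
  fixes a :: "'i \<Rightarrow> nat \<Rightarrow> complex"
  assumes "finite I" "\<And>i. i \<in> I \<Longrightarrow> summable (\<lambda>n. (cmod (a i n))\<^sup>2)"
  shows "summable (\<lambda>n. (cmod (\<Sum>i\<in>I. a i n))\<^sup>2)"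
  using assms
proof (induction rule: finite_induct)
  case (insert i I)
  show ?case
  proof (rule summable_comparison_test')
    show "summable (\<lambda>n. 2 * (cmod (a i n))\<^sup>2 + 2 * (cmod (\<Sum>i\<in>I. a i n))\<^sup>2)"
      using insert by (intro summable_add summable_mult) auto
  qed (use insert.hyps norm_add_square_le in auto)
qed simp

lemma hardy2_sum:
  assumes "finite I" "\<And>i. i \<in> I \<Longrightarrow> f i \<in> hardy2"
  shows "(\<lambda>z. \<Sum>i\<in>I. c i * f i z) \<in> hardy2"
proof -
  have hol: "\<And>i. i \<in> I \<Longrightarrow> f i holomorphic_on unit_disk"
    using assms(2) by (simp add: hardy2_def)
  have "summable (\<lambda>n. (cmod (\<Sum>i\<in>I. c i * taylor_coeff (f i) n))\<^sup>2)"
    using assms(2) by (intro summable_norm_square_sum assms(1))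
      (auto simp: norm_mult power_mult_distrib hardy2_def intro!: summable_mult)
  then show ?thesis
    using hol assms(1)
    by (auto simp: hardy2_def taylor_coeff_sum[OF assms(1) hol] intro!: holomorphic_intros)
qed

lemma hardy2_diff:
  assumes "f \<in> hardy2" "g \<in> hardy2"
  shows "(\<lambda>z. f z - g z) \<in> hardy2"
proof -
  have "(\<lambda>z. \<Sum>b\<in>UNIV. (if b then 1 else -1) * (if b then f else g) z) \<in> hardy2"
    by (rule hardy2_sum) (use assms in auto)
  then show ?thesis by (simp add: UNIV_bool)
qed

lemma h2_inner_sums:
  assumes "f \<in> hardy2" "g \<in> hardy2"
  shows "(\<lambda>n. taylor_coeff f n * cnj (taylor_coeff g n)) sums h2_inner f g"
  unfolding h2_inner_def
proof (rule summable_sums, rule summable_norm_cancel, rule summable_comparison_test')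
  show "summable (\<lambda>n. (cmod (taylor_coeff f n))\<^sup>2 + (cmod (taylor_coeff g n))\<^sup>2)"
    using assms by (intro summable_add hardy2_summable)
  show "norm (norm (taylor_coeff f n * cnj (taylor_coeff g n)))
      \<le> (cmod (taylor_coeff f n))\<^sup>2 + (cmod (taylor_coeff g n))\<^sup>2" for n
  proof -
    have "2 * (cmod (taylor_coeff f n) * cmod (taylor_coeff g n))
        \<le> (cmod (taylor_coeff f n))\<^sup>2 + (cmod (taylor_coeff g n))\<^sup>2"
      using sum_squares_bound[of "cmod (taylor_coeff f n)" "cmod (taylor_coeff g n)"] by simp
    moreover have "0 \<le> cmod (taylor_coeff f n) * cmod (taylor_coeff g n)" by simp
    moreover have "norm (norm (taylor_coeff f n * cnj (taylor_coeff g n)))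
        = cmod (taylor_coeff f n) * cmod (taylor_coeff g n)" by (simp add: norm_mult)
    ultimately show ?thesis by linarith
  qed
qed

lemma h2_inner_self:
  assumes "f \<in> hardy2"
  shows "h2_inner f f = of_real (\<Sum>n. (cmod (taylor_coeff f n))\<^sup>2)"
proof -
  have "(\<lambda>n. of_real ((cmod (taylor_coeff f n))\<^sup>2)) sums
      (of_real (\<Sum>n. (cmod (taylor_coeff f n))\<^sup>2) :: complex)"
    by (intro sums_of_real summable_sums hardy2_summable assms)
  then show ?thesis
    unfolding h2_inner_def complex_norm_square by (metis sums_unique)
qed

lemma h2_norm_square:
  assumes "f \<in> hardy2"
  shows "(h2_norm f)\<^sup>2 = (\<Sum>n. (cmod (taylor_coeff f n))\<^sup>2)"
  unfolding h2_norm_def h2_inner_self[OF assms]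
  by (simp add: suminf_nonneg hardy2_summable assms)

lemma h2_norm_square_sums:
  assumes "f \<in> hardy2"
  shows "(\<lambda>n. (cmod (taylor_coeff f n))\<^sup>2) sums (h2_norm f)\<^sup>2"
  using h2_norm_square[OF assms] hardy2_summable[OF assms] by (simp add: sums_iff)

lemma h2_norm_nonneg: "f \<in> hardy2 \<Longrightarrow> 0 \<le> h2_norm f"
  by (simp add: h2_norm_def h2_inner_self suminf_nonneg hardy2_summable)

lemma h2_inner_self_norm:
  assumes "f \<in> hardy2"
  shows "h2_inner f f = of_real ((h2_norm f)\<^sup>2)"
  by (simp only: h2_inner_self[OF assms] h2_norm_square[OF assms])

lemma sum_taylor_le_h2_norm:
  assumes "f \<in> hardy2" "finite J"
  shows "(\<Sum>n\<in>J. (cmod (taylor_coeff f n))\<^sup>2) \<le> (h2_norm f)\<^sup>2"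
  unfolding h2_norm_square[OF assms(1)]
  by (intro sum_le_suminf hardy2_summable assms) auto

lemma h2_norm_leI:
  assumes "f \<in> hardy2" "\<And>N. (\<Sum>n<N. (cmod (taylor_coeff f n))\<^sup>2) \<le> C"
  shows "(h2_norm f)\<^sup>2 \<le> C"
  unfolding h2_norm_square[OF assms(1)]
  by (intro suminf_le_const hardy2_summable assms)

lemma taylor_coeff_le_h2_norm:
  assumes "f \<in> hardy2"
  shows "cmod (taylor_coeff f n) \<le> h2_norm f"
  using sum_taylor_le_h2_norm[OF assms, of "{n}"] h2_norm_nonneg[OF assms]
  by (simp add: power2_le_iff_abs_le)

lemma h2_norm_triangle_diff:
  assumes "f \<in> hardy2" "g \<in> hardy2"
  shows "h2_norm g \<le> h2_norm f + h2_norm (\<lambda>z. f z - g z)"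
proof -
  let ?d = "\<lambda>z. f z - g z"
  have d: "?d \<in> hardy2" by (rule hardy2_diff[OF assms])
  have le: "L2_set (\<lambda>n. cmod (taylor_coeff k n)) {..<N} \<le> h2_norm k" if "k \<in> hardy2" for k N
    unfolding L2_set_def
    using sum_taylor_le_h2_norm[OF that, of "{..<N}"] h2_norm_nonneg[OF that]
    by (intro real_le_lsqrt) (auto intro: sum_nonneg)
  have "(h2_norm g)\<^sup>2 \<le> (h2_norm f + h2_norm ?d)\<^sup>2"
  proof (rule h2_norm_leI[OF assms(2)])
    fix N
    have tri: "cmod (taylor_coeff g n) \<le> cmod (taylor_coeff f n) + cmod (taylor_coeff ?d n)" for n
      using norm_triangle_ineq4[of "taylor_coeff f n" "taylor_coeff ?d n"] assms
      by (simp add: taylor_coeff_diff hardy2_def)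
    have "L2_set (\<lambda>n. cmod (taylor_coeff g n)) {..<N}
        \<le> L2_set (\<lambda>n. cmod (taylor_coeff f n) + cmod (taylor_coeff ?d n)) {..<N}"
      by (intro L2_set_mono tri) auto
    also have "\<dots> \<le> L2_set (\<lambda>n. cmod (taylor_coeff f n)) {..<N}
        + L2_set (\<lambda>n. cmod (taylor_coeff ?d n)) {..<N}"
      by (rule L2_set_triangle_ineq)
    also have "\<dots> \<le> h2_norm f + h2_norm ?d"
      by (intro add_mono le assms d)
    finally have "(L2_set (\<lambda>n. cmod (taylor_coeff g n)) {..<N})\<^sup>2 \<le> (h2_norm f + h2_norm ?d)\<^sup>2"
      by (intro power_mono) auto
    then show "(\<Sum>n<N. (cmod (taylor_coeff g n))\<^sup>2) \<le> (h2_norm f + h2_norm ?d)\<^sup>2"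
      by (simp add: L2_set_def sum_nonneg)
  qed
  then show ?thesis
    using h2_norm_nonneg[OF assms(1)] h2_norm_nonneg[OF d]
    by (intro power2_le_imp_le[of "h2_norm g"]) auto
qed

lemma h2_inner_sum_sum:
  assumes "finite I" "\<And>i. i \<in> I \<Longrightarrow> f i \<in> hardy2"
  shows "h2_inner (\<lambda>z. \<Sum>i\<in>I. c i * f i z) (\<lambda>z. \<Sum>i\<in>I. c i * f i z)
    = (\<Sum>i\<in>I. \<Sum>j\<in>I. c i * cnj (c j) * h2_inner (f i) (f j))"
proof -
  have hol: "\<And>i. i \<in> I \<Longrightarrow> f i holomorphic_on unit_disk"
    using assms(2) by (simp add: hardy2_def)
  have "(\<lambda>n. \<Sum>i\<in>I. \<Sum>j\<in>I. c i * cnj (c j) *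
      (taylor_coeff (f i) n * cnj (taylor_coeff (f j) n))) sums
      (\<Sum>i\<in>I. \<Sum>j\<in>I. c i * cnj (c j) * h2_inner (f i) (f j))"
    by (intro sums_sum sums_mult h2_inner_sums assms)
  moreover have "(\<Sum>i\<in>I. \<Sum>j\<in>I. c i * cnj (c j) *
      (taylor_coeff (f i) n * cnj (taylor_coeff (f j) n)))
      = taylor_coeff (\<lambda>z. \<Sum>i\<in>I. c i * f i z) n
        * cnj (taylor_coeff (\<lambda>z. \<Sum>i\<in>I. c i * f i z) n)" for n
    by (simp add: taylor_coeff_sum[OF assms(1) hol] sum_product mult_ac)
  ultimately show ?thesis
    unfolding h2_inner_def[of "\<lambda>z. \<Sum>i\<in>I. c i * f i z"] by (simp add: sums_iff)
qed

section \<open>Boundedness of the composition operator\<close>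

lemma taylor_coeff_cong:
  assumes "\<And>z. z \<in> unit_disk \<Longrightarrow> f z = g z"
  shows "taylor_coeff f n = taylor_coeff g n"
proof -
  have "eventually (\<lambda>z. z \<in> unit_disk) (nhds (0::complex))"
    by (intro eventually_nhds_in_open) auto
  then have "eventually (\<lambda>z. f z = g z) (nhds 0)"
    by eventually_elim (rule assms)
  then show ?thesis
    unfolding taylor_coeff_def by (simp cong: higher_deriv_cong_ev)
qed

lemma higher_deriv_sums:
  assumes "f holomorphic_on unit_disk" "cmod z < 1"
  shows "(\<lambda>k. taylor_coeff f (k + n) * (fact (k + n) / fact k) * z ^ k) sums (deriv ^^ n) f z"
proof -
  have "(deriv ^^ n) f holomorphic_on unit_disk"
    by (intro holomorphic_higher_deriv assms) auto
  from taylor_sums[OF this assms(2)] show ?thesis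
    by (simp add: taylor_coeff_def funpow_add)
qed

lemma half_plus_half_in_unit_disk: "cmod z < 1 \<Longrightarrow> cmod ((1 + z) / 2) < 1"
  using norm_triangle_ineq[of 1 z] by (simp add: norm_divide)

text \<open>
  The \<open>n\<close>-th derivative of the composition at \<open>0\<close> is \<open>2 ^ -n\<close> times that of \<open>f\<close> at \<open>1 / 2\<close>,
  which the Taylor series of \<open>f\<close> at \<open>0\<close> computes. This identifies the matrix of the composition
  operator.
\<close>

lemma taylor_coeff_compose_half_sums:
  assumes "f holomorphic_on unit_disk"
  shows "(\<lambda>k. of_real (real (k choose n) / 2 ^ k) * taylor_coeff f k)
    sums taylor_coeff (\<lambda>z. f ((1 + z) / 2)) n"
proof -
  have disk: "1 / 2 * w + 1 / 2 \<in> unit_disk" if "w \<in> unit_disk" for w :: complex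
    using half_plus_half_in_unit_disk[of w] that by (simp add: field_simps)
  have "(deriv ^^ n) (\<lambda>w. f (1 / 2 * w + 1 / 2)) 0 = (1 / 2) ^ n * (deriv ^^ n) f (1 / 2 * 0 + 1 / 2)"
    by (rule higher_deriv_compose_linear'[OF assms, of unit_disk]) (use disk in auto)
  also have "(\<lambda>w. f (1 / 2 * w + 1 / 2)) = (\<lambda>z. f ((1 + z) / 2))"
    by (simp add: add_divide_distrib add.commute)
  finally have d: "taylor_coeff (\<lambda>z. f ((1 + z) / 2)) n = (1 / 2) ^ n / fact n * (deriv ^^ n) f (1 / 2)"
    by (simp add: taylor_coeff_def)
  have "(\<lambda>k. taylor_coeff f (k + n) * (fact (k + n) / fact k) * (1 / 2) ^ k) sums (deriv ^^ n) f (1 / 2)"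
    by (rule higher_deriv_sums[OF assms]) (simp add: norm_divide)
  then have "(\<lambda>k. (1 / 2) ^ n / fact n *
      (taylor_coeff f (k + n) * (fact (k + n) / fact k) * (1 / 2) ^ k))
      sums taylor_coeff (\<lambda>z. f ((1 + z) / 2)) n"
    unfolding d by (rule sums_mult)
  also have "(\<lambda>k. (1 / 2) ^ n / fact n *
      (taylor_coeff f (k + n) * (fact (k + n) / fact k) * (1 / 2) ^ k))
      = (\<lambda>k. of_real (real ((k + n) choose n) / 2 ^ (k + n)) * taylor_coeff f (k + n))"
  proof
    fix k
    have "complex_of_real (real ((k + n) choose n)) = fact (k + n) / (fact n * fact k)"
      using binomial_fact[of n "k + n", where ?'a = complex] by simp
    then show "(1 / 2) ^ n / fact n * (taylor_coeff f (k + n) * (fact (k + n) / fact k) * (1 / 2) ^ k)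
      = of_real (real ((k + n) choose n) / 2 ^ (k + n)) * taylor_coeff f (k + n)"
      by (simp add: power_add field_simps)
  qed
  finally show ?thesis
    by (subst (asm) sums_zero_iff_shift) (auto simp: binomial_eq_0)
qed

text \<open>
  Pascal's rule expresses each row sum as the mean of itself and the preceding one, so all rows
  have the same sum as the geometric row \<open>n = 0\<close>. On partial sums only the inequality survives.
\<close>

lemma binomial_row_sum_le:
  "(\<Sum>k<N. real (k choose n) / 2 ^ k) \<le> 2"
proof (induction n arbitrary: N)
  case 0
  have "(\<Sum>k<N. (1 / 2 :: real) ^ k) \<le> (\<Sum>k. (1 / 2) ^ k)"
    by (intro sum_le_suminf summable_geometric) auto
  also have "\<dots> = 2" by (subst suminf_geometric) auto
  finally show ?case by (simp add: power_divide)
next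
  case (Suc n)
  show ?case
  proof (induction N)
    case (Suc N)
    have "(\<Sum>k<Suc N. real (k choose Suc n) / 2 ^ k)
        = (\<Sum>k<N. real (k choose n) / 2 ^ k) / 2 + (\<Sum>k<N. real (k choose Suc n) / 2 ^ k) / 2"
      unfolding sum.lessThan_Suc_shift
      by (simp add: sum_divide_distrib sum.distrib[symmetric] add_divide_distrib mult.commute)
    then show ?case
      using Suc.IH \<open>\<And>N. (\<Sum>k<N. real (k choose n) / 2 ^ k) \<le> 2\<close>[of N] by linarith
  qed simp
qed

lemma binomial_column_sum_le:
  "(\<Sum>n<N. real (k choose n) / 2 ^ k) \<le> 1"
proof -
  have "(\<Sum>n<N. k choose n) \<le> (\<Sum>n\<le>N + k. k choose n)"
    by (intro sum_mono2) auto
  also have "\<dots> = (\<Sum>n\<le>k. k choose n)"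
    by (intro sum.mono_neutral_right) (auto simp: binomial_eq_0)
  also have "\<dots> = 2 ^ k" by (rule choose_row_sum)
  finally have "real (\<Sum>n<N. k choose n) \<le> real (2 ^ k)"
    by (rule of_nat_mono)
  then show ?thesis
    by (simp add: sum_divide_distrib[symmetric] divide_le_eq)
qed

text \<open>
  The matrix of the operator in the monomial basis has the nonnegative entries \<open>binomial(k, n)
  / 2 ^ k\<close>; its rows sum to \<open>2\<close> and its columns to \<open>1\<close>, so that Schur's test bounds the square
  of its norm by \<open>2\<close>.
\<close>

lemma hardy2_compose_half:
  assumes "f \<in> hardy2"
  shows "(\<lambda>z. f ((1 + z) / 2)) \<in> hardy2" (is "?g \<in> _")
    and "(h2_norm (\<lambda>z. f ((1 + z) / 2)))\<^sup>2 \<le> 2 * (h2_norm f)\<^sup>2"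
proof -
  define M where "M n k = real (k choose n) / 2 ^ k" for n k
  have M: "0 \<le> M n k" for n k by (simp add: M_def)
  let ?a = "taylor_coeff f"
  have hol: "f holomorphic_on unit_disk" using assms by (simp add: hardy2_def)
  have finite_Schur: "(\<Sum>n<N. (cmod (\<Sum>k<K. of_real (M n k) * ?a k))\<^sup>2) \<le> 2 * (h2_norm f)\<^sup>2" for N K
  proof -
    have row: "(cmod (\<Sum>k<K. of_real (M n k) * ?a k))\<^sup>2 \<le> 2 * (\<Sum>k<K. M n k * (cmod (?a k))\<^sup>2)" for n
    proof -
      have "cmod (\<Sum>k<K. of_real (M n k) * ?a k) \<le> (\<Sum>k<K. sqrt (M n k) * (sqrt (M n k) * cmod (?a k)))"
        using M by (intro sum_norm_le) (simp add: norm_mult flip: mult.assoc)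
      then have "(cmod (\<Sum>k<K. of_real (M n k) * ?a k))\<^sup>2
          \<le> (\<Sum>k<K. sqrt (M n k) * (sqrt (M n k) * cmod (?a k)))\<^sup>2"
        by (intro power_mono) auto
      also have "\<dots> \<le> (\<Sum>k<K. (sqrt (M n k))\<^sup>2) * (\<Sum>k<K. (sqrt (M n k) * cmod (?a k))\<^sup>2)"
        by (rule Cauchy_Schwarz_ineq_sum)
      also have "\<dots> = (\<Sum>k<K. M n k) * (\<Sum>k<K. M n k * (cmod (?a k))\<^sup>2)"
        using M by (simp add: power_mult_distrib)
      also have "\<dots> \<le> 2 * (\<Sum>k<K. M n k * (cmod (?a k))\<^sup>2)"
        using binomial_row_sum_le[of n K] M by (intro mult_right_mono sum_nonneg) (auto simp: M_def)
      finally show ?thesis .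
    qed
    have "(\<Sum>n<N. (cmod (\<Sum>k<K. of_real (M n k) * ?a k))\<^sup>2)
        \<le> (\<Sum>n<N. 2 * (\<Sum>k<K. M n k * (cmod (?a k))\<^sup>2))"
      by (intro sum_mono row)
    also have "\<dots> = 2 * (\<Sum>k<K. (\<Sum>n<N. M n k) * (cmod (?a k))\<^sup>2)"
      unfolding sum_distrib_left[symmetric] sum_distrib_right by (subst sum.swap) simp
    also have "\<dots> \<le> 2 * (\<Sum>k<K. 1 * (cmod (?a k))\<^sup>2)"
      using binomial_column_sum_le[of _ N]
      by (intro mult_left_mono sum_mono mult_right_mono) (auto simp: M_def)
    also have "\<dots> \<le> 2 * (h2_norm f)\<^sup>2"
      using sum_taylor_le_h2_norm[OF assms, of "{..<K}"] by simp
    finally show ?thesis .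
  qed
  have bound: "(\<Sum>n<N. (cmod (taylor_coeff ?g n))\<^sup>2) \<le> 2 * (h2_norm f)\<^sup>2" for N
  proof (rule LIMSEQ_le_const2)
    show "(\<lambda>K. \<Sum>n<N. (cmod (\<Sum>k<K. of_real (M n k) * ?a k))\<^sup>2)
        \<longlonglongrightarrow> (\<Sum>n<N. (cmod (taylor_coeff ?g n))\<^sup>2)"
      using taylor_coeff_compose_half_sums[OF hol]
      by (intro tendsto_intros) (auto simp: sums_def M_def)
  qed (use finite_Schur in auto)
  have "?g holomorphic_on unit_disk"
    using half_plus_half_in_unit_disk
    by (intro holomorphic_on_compose_gen[OF _ hol, unfolded o_def] holomorphic_intros) auto
  then show g: "?g \<in> hardy2"
    unfolding hardy2_def using bound by (auto intro!: summableI_nonneg_bounded)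
  show "(h2_norm ?g)\<^sup>2 \<le> 2 * (h2_norm f)\<^sup>2"
    by (rule h2_norm_leI[OF g bound])
qed

text \<open>
  The symbol is only prescribed on the disk, and its values elsewhere are irrelevant for the
  Taylor coefficients.
\<close>

lemma
  assumes \<phi>: "\<And>z. z \<in> unit_disk \<Longrightarrow> \<phi> z = (1 + z) / 2"
  shows composition_op_half_norm: "h2_norm (composition_op \<phi> f) = h2_norm (\<lambda>z. f ((1 + z) / 2))"
    and composition_op_half_hardy2: "f \<in> hardy2 \<Longrightarrow> composition_op \<phi> f \<in> hardy2"
    and composition_op_half_bounded: "f \<in> hardy2 \<Longrightarrow> h2_norm (composition_op \<phi> f) \<le> sqrt 2 * h2_norm f"
proof -
  have eq: "composition_op \<phi> f z = f ((1 + z) / 2)" if "z \<in> unit_disk" for z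
    unfolding composition_op_def o_def \<phi>[OF that] ..
  have taylor: "taylor_coeff (composition_op \<phi> f) n = taylor_coeff (\<lambda>z. f ((1 + z) / 2)) n" for n
    by (rule taylor_coeff_cong[OF eq])
  show norm: "h2_norm (composition_op \<phi> f) = h2_norm (\<lambda>z. f ((1 + z) / 2))"
    by (simp add: h2_norm_def h2_inner_def taylor)
  assume f: "f \<in> hardy2"
  have "composition_op \<phi> f holomorphic_on unit_disk \<longleftrightarrow> (\<lambda>z. f ((1 + z) / 2)) holomorphic_on unit_disk"
    by (rule holomorphic_cong[OF refl eq])
  then show "composition_op \<phi> f \<in> hardy2"
    using hardy2_compose_half(1)[OF f] by (simp add: hardy2_def taylor)
  show "h2_norm (composition_op \<phi> f) \<le> sqrt 2 * h2_norm f"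
  proof (rule power2_le_imp_le)
    show "(h2_norm (composition_op \<phi> f))\<^sup>2 \<le> (sqrt 2 * h2_norm f)\<^sup>2"
      using hardy2_compose_half(2)[OF f] unfolding norm power_mult_distrib by simp
  qed (simp add: h2_norm_nonneg f)
qed

section \<open>Hilbert--Schmidt operators on Bessel families\<close>

lemma orthonormal_sum_norm:
  assumes "finite F" "F \<subseteq> hardy2"
    and "\<And>e e'. e \<in> F \<Longrightarrow> e' \<in> F \<Longrightarrow> h2_inner e e' = (if e = e' then 1 else 0)"
  shows "(h2_norm (\<lambda>z. \<Sum>e\<in>F. c e * e z))\<^sup>2 = (\<Sum>e\<in>F. (cmod (c e))\<^sup>2)"
proof -
  have "complex_of_real ((h2_norm (\<lambda>z. \<Sum>e\<in>F. c e * e z))\<^sup>2)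
      = h2_inner (\<lambda>z. \<Sum>e\<in>F. c e * e z) (\<lambda>z. \<Sum>e\<in>F. c e * e z)"
    by (rule h2_inner_self_norm[symmetric], rule hardy2_sum) (use assms in auto)
  also have "\<dots> = (\<Sum>e\<in>F. \<Sum>e'\<in>F. c e * cnj (c e') * h2_inner e e')"
    using assms(2) by (intro h2_inner_sum_sum assms(1)) auto
  also have "\<dots> = (\<Sum>e\<in>F. \<Sum>e'\<in>F. if e = e' then c e * cnj (c e') else 0)"
    by (intro sum.cong refl) (auto simp: assms(3))
  also have "\<dots> = of_real (\<Sum>e\<in>F. (cmod (c e))\<^sup>2)"
    using assms(1) by (simp add: complex_norm_square flip: of_real_power)
  finally show ?thesis by (simp only: of_real_eq_iff)
qed

text \<open>
  On finite combinations of basis elements this is the Cauchy--Schwarz inequality, and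
  continuity extends it to \<open>V\<close>.
\<close>

lemma functional_bound_orthonormal_basis:
  assumes E: "orthonormal_basis_of V E" and V: "V \<subseteq> hardy2"
    and lin: "\<And>F c. finite F \<Longrightarrow> F \<subseteq> E \<Longrightarrow> L (\<lambda>z. \<Sum>e\<in>F. c e * e z) = (\<Sum>e\<in>F. c e * L e)"
    and cont: "\<And>f g. f \<in> hardy2 \<Longrightarrow> g \<in> hardy2 \<Longrightarrow>
      cmod (L f - L g) \<le> C * h2_norm (\<lambda>z. f z - g z)" and C: "0 \<le> C"
    and summable: "(\<lambda>e. (cmod (L e))\<^sup>2) summable_on E" and f: "f \<in> V"
  shows "(cmod (L f))\<^sup>2 \<le> (\<Sum>\<^sub>\<infinity>e\<in>E. (cmod (L e))\<^sup>2) * (h2_norm f)\<^sup>2"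
proof -
  define S where "S = sqrt (\<Sum>\<^sub>\<infinity>e\<in>E. (cmod (L e))\<^sup>2)"
  have S: "0 \<le> S" by (simp add: S_def infsum_nonneg)
  have fH: "f \<in> hardy2" using f V by auto
  have "cmod (L f) \<le> S * h2_norm f + \<delta>" if \<delta>: "\<delta> > 0" for \<delta>
  proof -
    define \<epsilon> where "\<epsilon> = \<delta> / (S + C + 1)"
    have \<epsilon>: "\<epsilon> > 0" using \<delta> S C by (simp add: \<epsilon>_def)
    obtain F c where F: "finite F" "F \<subseteq> E"
      and close: "h2_norm (\<lambda>z. f z - (\<Sum>e\<in>F. c e * e z)) < \<epsilon>"
      using E f \<epsilon> unfolding orthonormal_basis_of_def by meson
    let ?g = "\<lambda>z. \<Sum>e\<in>F. c e * e z"
    have FH: "F \<subseteq> hardy2" using F E V by (auto simp: orthonormal_basis_of_def)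
    have gH: "?g \<in> hardy2" by (rule hardy2_sum) (use F FH in auto)
    have norm_g: "(h2_norm ?g)\<^sup>2 = (\<Sum>e\<in>F. (cmod (c e))\<^sup>2)"
    proof (rule orthonormal_sum_norm[OF F(1) FH])
      fix e e' assume "e \<in> F" "e' \<in> F"
      then have "e \<in> E" "e' \<in> E" using F by auto
      then show "h2_inner e e' = (if e = e' then 1 else 0)"
        using E unfolding orthonormal_basis_of_def by blast
    qed
    have "cmod (L ?g) \<le> (\<Sum>e\<in>F. cmod (c e) * cmod (L e))"
      unfolding lin[OF F] by (intro sum_norm_le) (simp add: norm_mult)
    also have "\<dots> \<le> h2_norm ?g * S"
    proof (rule power2_le_imp_le)
      have "(\<Sum>e\<in>F. cmod (c e) * cmod (L e))\<^sup>2
          \<le> (\<Sum>e\<in>F. (cmod (c e))\<^sup>2) * (\<Sum>e\<in>F. (cmod (L e))\<^sup>2)"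
        by (rule Cauchy_Schwarz_ineq_sum)
      also have "\<dots> \<le> (h2_norm ?g)\<^sup>2 * S\<^sup>2"
        unfolding norm_g S_def using F
        by (auto simp: infsum_nonneg sum_nonneg intro!: mult_left_mono finite_sum_le_infsum summable)
      finally show "(\<Sum>e\<in>F. cmod (c e) * cmod (L e))\<^sup>2 \<le> (h2_norm ?g * S)\<^sup>2"
        by (simp add: power_mult_distrib)
    qed (use h2_norm_nonneg[OF gH] S in simp)
    also have "\<dots> \<le> (h2_norm f + \<epsilon>) * S"
      using h2_norm_triangle_diff[OF fH gH] close S by (intro mult_right_mono) auto
    finally have "cmod (L ?g) \<le> (h2_norm f + \<epsilon>) * S" .
    moreover have "cmod (L f) \<le> cmod (L ?g) + cmod (L f - L ?g)"
      using norm_triangle_ineq[of "L ?g" "L f - L ?g"] by simp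
    moreover have "cmod (L f - L ?g) \<le> C * \<epsilon>"
      using cont[OF fH gH] close C by (meson less_imp_le mult_left_mono order_trans)
    ultimately have "cmod (L f) \<le> S * h2_norm f + (S + C) * \<epsilon>"
      by (simp add: algebra_simps)
    also have "(S + C) * \<epsilon> \<le> (S + C + 1) * \<epsilon>" using \<epsilon> by simp
    also have "\<dots> = \<delta>" using S C by (simp add: \<epsilon>_def)
    finally show ?thesis by simp
  qed
  then have "cmod (L f) \<le> S * h2_norm f" by (rule field_le_epsilon)
  then have "(cmod (L f))\<^sup>2 \<le> (S * h2_norm f)\<^sup>2" by (intro power_mono) auto
  then show ?thesis by (simp add: S_def power_mult_distrib infsum_nonneg)
qed

text \<open>
  If the synthesis map \<open>c \<mapsto> \<Sum>i. c i * \<kappa> i\<close> has squared norm at most \<open>B\<close>, composing it with a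
  Hilbert--Schmidt operator multiplies the squared Hilbert--Schmidt norm by at most \<open>B\<close>. The
  proof treats the operator row by row, a row being the functional that reads off one Taylor
  coefficient of the image: by duality, the values of this functional on the family are
  controlled by its norm, hence by its values on the basis.
\<close>

lemma hilbert_schmidt_bessel:
  fixes \<phi> :: "complex \<Rightarrow> complex" and \<kappa> :: "'i \<Rightarrow> complex \<Rightarrow> complex"
  defines "T \<equiv> composition_op \<phi>"
  assumes T: "\<And>f. f \<in> hardy2 \<Longrightarrow> T f \<in> hardy2"
    and bounded: "\<And>f. f \<in> hardy2 \<Longrightarrow> h2_norm (T f) \<le> C * h2_norm f" and C: "0 \<le> C"
    and E: "orthonormal_basis_of V E" and V: "V \<subseteq> hardy2"
    and summable: "(\<lambda>e. (h2_norm (T e))\<^sup>2) summable_on E"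
    and I: "finite I" and \<kappa>: "\<And>i. i \<in> I \<Longrightarrow> \<kappa> i \<in> hardy2"
    and span: "\<And>c. (\<lambda>z. \<Sum>i\<in>I. c i * \<kappa> i z) \<in> V"
    and bessel: "\<And>c. (h2_norm (\<lambda>z. \<Sum>i\<in>I. c i * \<kappa> i z))\<^sup>2 \<le> B * (\<Sum>i\<in>I. (cmod (c i))\<^sup>2)"
    and B: "0 \<le> B"
  shows "(\<Sum>i\<in>I. (h2_norm (T (\<kappa> i)))\<^sup>2) \<le> B * (\<Sum>\<^sub>\<infinity>e\<in>E. (h2_norm (T e))\<^sup>2)"
proof -
  define L where "L j f = taylor_coeff (T f) j" for j f
  have EH: "E \<subseteq> hardy2" using E V by (auto simp: orthonormal_basis_of_def)
  have L_sum: "L j (\<lambda>z. \<Sum>i\<in>A. c i * f i z) = (\<Sum>i\<in>A. c i * L j (f i))"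
    if "finite A" "\<And>i. i \<in> A \<Longrightarrow> f i \<in> hardy2"
    for j and A :: "'b set" and c and f :: "'b \<Rightarrow> complex \<Rightarrow> complex"
  proof -
    have "T (\<lambda>z. \<Sum>i\<in>A. c i * f i z) = (\<lambda>z. \<Sum>i\<in>A. c i * T (f i) z)"
      by (simp add: T_def composition_op_def o_def)
    then show ?thesis
      unfolding L_def using T that(2) by (simp add: taylor_coeff_sum that(1) hardy2_holomorphic)
  qed
  have cont: "cmod (L j f - L j g) \<le> C * h2_norm (\<lambda>z. f z - g z)"
    if "f \<in> hardy2" "g \<in> hardy2" for j f g
  proof -
    have d: "(\<lambda>z. f z - g z) \<in> hardy2" by (rule hardy2_diff[OF that])
    have "T (\<lambda>z. f z - g z) = (\<lambda>z. T f z - T g z)"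
      by (simp add: T_def composition_op_def o_def)
    then have "L j f - L j g = L j (\<lambda>z. f z - g z)"
      unfolding L_def using T that by (simp add: taylor_coeff_diff hardy2_holomorphic)
    also have "cmod \<dots> \<le> h2_norm (T (\<lambda>z. f z - g z))"
      unfolding L_def by (intro taylor_coeff_le_h2_norm T d)
    also have "\<dots> \<le> C * h2_norm (\<lambda>z. f z - g z)" by (rule bounded[OF d])
    finally show ?thesis .
  qed
  have L_summable: "(\<lambda>e. (cmod (L j e))\<^sup>2) summable_on E" for j
  proof (rule summable_on_comparison_test[OF summable])
    fix e assume "e \<in> E"
    then have "e \<in> hardy2" using EH by auto
    from sum_taylor_le_h2_norm[OF T[OF this], of "{j}"]
    show "(cmod (L j e))\<^sup>2 \<le> (h2_norm (T e))\<^sup>2" by (simp add: L_def)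
  qed auto
  have row: "(\<Sum>i\<in>I. (cmod (L j (\<kappa> i)))\<^sup>2) \<le> B * (\<Sum>\<^sub>\<infinity>e\<in>E. (cmod (L j e))\<^sup>2)" for j
  proof -
    define s where "s = (\<Sum>i\<in>I. (cmod (L j (\<kappa> i)))\<^sup>2)"
    define S where "S = (\<Sum>\<^sub>\<infinity>e\<in>E. (cmod (L j e))\<^sup>2)"
    have S: "0 \<le> S" by (simp add: S_def infsum_nonneg)
    have s: "0 \<le> s" by (simp add: s_def sum_nonneg)
    let ?f = "\<lambda>z. \<Sum>i\<in>I. cnj (L j (\<kappa> i)) * \<kappa> i z"
    have "L j ?f = of_real s"
    proof (subst L_sum[OF I \<kappa>])
      have "cnj w * w = of_real ((cmod w)\<^sup>2)" for w
        by (simp only: complex_norm_square mult.commute)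
      then show "(\<Sum>i\<in>I. cnj (L j (\<kappa> i)) * L j (\<kappa> i)) = of_real s"
        by (simp add: s_def)
    qed auto
    then have "s\<^sup>2 = (cmod (L j ?f))\<^sup>2" by simp
    also have "\<dots> \<le> S * (h2_norm ?f)\<^sup>2"
      unfolding S_def
      by (rule functional_bound_orthonormal_basis[OF E V _ cont C L_summable span])
        (use EH in \<open>auto intro!: L_sum\<close>)
    also have "\<dots> \<le> S * (B * s)"
      using bessel[of "\<lambda>i. cnj (L j (\<kappa> i))"] S by (intro mult_left_mono) (auto simp: s_def)
    finally have "s * s \<le> (B * S) * s" by (simp add: power2_eq_square mult_ac)
    then have "s \<le> B * S"
      using s S B by (cases "s = 0") (auto simp: mult_le_cancel_right)
    then show ?thesis by (simp add: s_def S_def)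
  qed
  have "(\<Sum>i\<in>I. \<Sum>j<J. (cmod (L j (\<kappa> i)))\<^sup>2) \<le> B * (\<Sum>\<^sub>\<infinity>e\<in>E. (h2_norm (T e))\<^sup>2)" for J
  proof -
    have "((\<lambda>e. \<Sum>j<J. (cmod (L j e))\<^sup>2) has_sum (\<Sum>j<J. \<Sum>\<^sub>\<infinity>e\<in>E. (cmod (L j e))\<^sup>2)) E"
      by (induction J) (auto intro!: has_sum_add has_sum_infsum L_summable)
    then have le: "(\<Sum>j<J. \<Sum>\<^sub>\<infinity>e\<in>E. (cmod (L j e))\<^sup>2) \<le> (\<Sum>\<^sub>\<infinity>e\<in>E. (h2_norm (T e))\<^sup>2)"
      by (rule has_sum_mono[OF _ has_sum_infsum[OF summable]])
        (use EH in \<open>auto simp: L_def intro!: sum_taylor_le_h2_norm T\<close>)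
    have "(\<Sum>i\<in>I. \<Sum>j<J. (cmod (L j (\<kappa> i)))\<^sup>2) = (\<Sum>j<J. \<Sum>i\<in>I. (cmod (L j (\<kappa> i)))\<^sup>2)"
      by (rule sum.swap)
    also have "\<dots> \<le> (\<Sum>j<J. B * (\<Sum>\<^sub>\<infinity>e\<in>E. (cmod (L j e))\<^sup>2))" by (intro sum_mono row)
    also have "\<dots> = B * (\<Sum>j<J. \<Sum>\<^sub>\<infinity>e\<in>E. (cmod (L j e))\<^sup>2)"
      by (simp add: sum_distrib_left)
    also have "\<dots> \<le> B * (\<Sum>\<^sub>\<infinity>e\<in>E. (h2_norm (T e))\<^sup>2)"
      by (intro mult_left_mono le B)
    finally show ?thesis .
  qed
  moreover have "(\<lambda>J. \<Sum>i\<in>I. \<Sum>j<J. (cmod (L j (\<kappa> i)))\<^sup>2) \<longlonglongrightarrow> (\<Sum>i\<in>I. (h2_norm (T (\<kappa> i)))\<^sup>2)"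
    using h2_norm_square_sums[OF T[OF \<kappa>]] by (intro tendsto_sum) (auto simp: sums_def L_def)
  ultimately show ?thesis
    by (intro LIMSEQ_le_const2) auto
qed

section \<open>Blaschke products\<close>

text \<open>
  The identity behind the Schwarz--Pick lemma. It bounds the denominator of a Blaschke factor
  from below by the distance to the zero, and it evaluates the defect \<open>1 - |b|\<^sup>2\<close> of the
  factor.
\<close>

lemma cmod_one_minus_cnj_mult_square:
  "(cmod (1 - cnj a * z))\<^sup>2 = (cmod (z - a))\<^sup>2 + (1 - (cmod a)\<^sup>2) * (1 - (cmod z)\<^sup>2)"
  unfolding cmod_power2 by (simp add: power2_eq_square algebra_simps)

lemma cmod_diff_le_one_minus_cnj_mult:
  assumes "cmod a \<le> 1" "cmod z \<le> 1"
  shows "cmod (z - a) \<le> cmod (1 - cnj a * z)"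
proof (rule power2_le_imp_le)
  have "0 \<le> (1 - (cmod a)\<^sup>2) * (1 - (cmod z)\<^sup>2)"
    using assms by (simp add: power_le_one)
  then show "(cmod (z - a))\<^sup>2 \<le> (cmod (1 - cnj a * z))\<^sup>2"
    by (simp add: cmod_one_minus_cnj_mult_square)
qed auto

lemma one_minus_le_cmod_one_minus_cnj_mult:
  assumes "cmod a \<le> 1"
  shows "1 - cmod z \<le> cmod (1 - cnj a * z)"
proof -
  have "cmod (cnj a * z) \<le> cmod z"
    using assms by (simp add: norm_mult mult_left_le_one_le)
  then show ?thesis using norm_triangle_ineq2[of 1 "cnj a * z"] by simp
qed

lemma one_minus_cnj_mult_nonzero:
  assumes "cmod a \<le> 1" "cmod z < 1"
  shows "1 - cnj a * z \<noteq> 0"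
  using one_minus_le_cmod_one_minus_cnj_mult[of a z] assms by auto

lemma cmod_blaschke_factor:
  assumes "a \<noteq> 0"
  shows "cmod (blaschke_factor a z) = cmod (z - a) / cmod (1 - cnj a * z)"
  using assms by (simp add: blaschke_factor_def norm_mult norm_divide)

lemma one_minus_cmod_blaschke_factor_square:
  assumes "a \<noteq> 0" "cmod a \<le> 1" "cmod z < 1"
  shows "1 - (cmod (blaschke_factor a z))\<^sup>2
    = (1 - (cmod z)\<^sup>2) * ((1 - (cmod a)\<^sup>2) / (cmod (1 - cnj a * z))\<^sup>2)"
proof -
  have "(cmod (1 - cnj a * z))\<^sup>2 \<noteq> 0"
    using one_minus_cnj_mult_nonzero[of a z] assms by simp
  then show ?thesis
    using cmod_one_minus_cnj_mult_square[of a z]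
    by (simp add: cmod_blaschke_factor assms power_divide field_simps)
qed

text \<open>
  The unimodular constant in the factor is chosen so that the numerator of the difference to
  \<open>1\<close> splits off \<open>1 - |a|\<close>; this is why the sum of these numbers controls the product.
\<close>

lemma cmod_blaschke_factor_minus_1_le:
  assumes "a \<noteq> 0" "cmod a \<le> 1" "cmod z < 1"
  shows "cmod (blaschke_factor a z - 1) \<le> 2 / (1 - cmod z) * (1 - cmod a)"
proof -
  have nz: "1 - cnj a * z \<noteq> 0" by (rule one_minus_cnj_mult_nonzero) (use assms in auto)
  have sq: "cnj a * a = of_real (cmod a) * of_real (cmod a)"
    using complex_norm_square[of a] by (simp add: mult.commute power2_eq_square)
  have "blaschke_factor a z - 1
      = - ((1 - of_real (cmod a)) * (of_real (cmod a) + cnj a * z) / (of_real (cmod a) * (1 - cnj a * z)))"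
    using nz assms(1) sq by (simp add: blaschke_factor_def divide_simps) (simp add: algebra_simps)
  also have "cmod \<dots> = (1 - cmod a) * cmod (of_real (cmod a) + cnj a * z) / (cmod a * cmod (1 - cnj a * z))"
  proof -
    have "cmod (1 - of_real (cmod a)) = 1 - cmod a"
      using assms(2) by (metis abs_of_nonneg diff_ge_0_iff_ge norm_of_real of_real_1 of_real_diff)
    then show ?thesis by (simp add: norm_mult norm_divide)
  qed
  also have "\<dots> \<le> (1 - cmod a) * (2 * cmod a) / (cmod a * (1 - cmod z))"
  proof (rule frac_le)
    have "cmod (of_real (cmod a) + cnj a * z) \<le> cmod a + cmod a * cmod z"
      using norm_triangle_ineq[of "of_real (cmod a)" "cnj a * z"] by (simp add: norm_mult)
    also have "\<dots> \<le> cmod a + cmod a * 1" using assms by (intro add_left_mono mult_left_mono) auto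
    finally show "(1 - cmod a) * cmod (of_real (cmod a) + cnj a * z) \<le> (1 - cmod a) * (2 * cmod a)"
      using assms by (intro mult_left_mono) auto
    show "cmod a * (1 - cmod z) \<le> cmod a * cmod (1 - cnj a * z)"
      using one_minus_le_cmod_one_minus_cnj_mult[of a z] assms by (intro mult_left_mono) auto
  qed (use assms in auto)
  also have "\<dots> = 2 / (1 - cmod z) * (1 - cmod a)" using assms by simp
  finally show ?thesis .
qed

locale blaschke_product =
  fixes a :: "nat \<Rightarrow> complex" and \<theta> :: "complex \<Rightarrow> complex"
  assumes zeros_nonzero: "a n \<noteq> 0"
    and zeros_in_disk: "cmod (a n) < 1"
    and summable_zeros: "summable (\<lambda>n. 1 - cmod (a n))"
    and product: "cmod z < 1 \<Longrightarrow> \<theta> z = (\<Prod>n. blaschke_factor (a n) z)"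
begin

lemma partial_products_tendsto:
  assumes "cmod z < 1"
  shows "(\<lambda>N. \<Prod>n<N. blaschke_factor (a n) z) \<longlonglongrightarrow> \<theta> z"
proof -
  have "summable (\<lambda>n. norm (blaschke_factor (a n) z - 1))"
    by (rule summable_comparison_test'[OF summable_mult[OF summable_zeros, of "2 / (1 - cmod z)"]])
      (use cmod_blaschke_factor_minus_1_le zeros_nonzero zeros_in_disk assms in \<open>auto simp: less_imp_le\<close>)
  then have "convergent_prod (\<lambda>n. blaschke_factor (a n) z)"
    by (intro abs_convergent_prod_imp_convergent_prod summable_imp_abs_convergent_prod)
  from convergent_prod_LIMSEQ[OF this] show ?thesis
    using product[OF assms] by (simp add: LIMSEQ_lessThan_iff_atMost)
qed

lemma theta_zero: "\<theta> (a n) = 0"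
proof -
  have "(\<Prod>k<N. blaschke_factor (a k) (a n)) = 0" if "N > n" for N
    using that by (auto simp: blaschke_factor_def)
  then have "(\<lambda>N. \<Prod>k<N. blaschke_factor (a k) (a n)) \<longlonglongrightarrow> 0"
    by (intro tendsto_eventually eventually_mono[OF eventually_gt_at_top[of n]])
  then show ?thesis
    using partial_products_tendsto[OF zeros_in_disk[of n]] LIMSEQ_unique by blast
qed

lemma theta_holomorphic: "\<theta> holomorphic_on unit_disk"
proof (rule holomorphic_uniform_sequence[where f = "\<lambda>N z. \<Prod>n<N. blaschke_factor (a n) z"])
  have factor: "blaschke_factor (a n) holomorphic_on unit_disk" for n
    unfolding blaschke_factor_def using one_minus_cnj_mult_nonzero[of "a n"] zeros_in_disk[of n]
    by (intro holomorphic_intros) (auto simp: zeros_nonzero)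
  then show "(\<lambda>z. \<Prod>n<N. blaschke_factor (a n) z) holomorphic_on unit_disk" for N
    by (intro holomorphic_on_prod)
  fix x :: complex assume x: "x \<in> unit_disk"
  define d where "d = (1 - cmod x) / 2"
  have d: "d > 0" using x by (simp add: d_def)
  have sub: "cmod z \<le> 1 - d" if "z \<in> cball x d" for z
    using that norm_triangle_ineq2[of z x] by (auto simp: d_def dist_norm norm_minus_commute field_simps)
  then have sub': "cball x d \<subseteq> unit_disk" using d by fastforce
  have "uniformly_convergent_on (cball x d) (\<lambda>N z. \<Prod>n<N. blaschke_factor (a n) z)"
  proof (rule uniformly_convergent_on_prod')
    show "continuous_on (cball x d) (blaschke_factor (a n))" for n
      using factor sub' by (meson continuous_on_subset holomorphic_on_imp_continuous_on)
    show "uniformly_convergent_on (cball x d) (\<lambda>N z. \<Sum>n<N. norm (blaschke_factor (a n) z - 1))"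
    proof (rule Weierstrass_m_test')
      show "summable (\<lambda>n. 2 / d * (1 - cmod (a n)))" by (intro summable_mult summable_zeros)
      fix n z assume z: "z \<in> cball x d"
      have z1: "cmod z < 1" using sub[OF z] d by simp
      have "norm (blaschke_factor (a n) z - 1) \<le> 2 / (1 - cmod z) * (1 - cmod (a n))"
        using zeros_nonzero zeros_in_disk z1 by (intro cmod_blaschke_factor_minus_1_le) (auto simp: less_imp_le)
      also have "\<dots> \<le> 2 / d * (1 - cmod (a n))"
        using sub[OF z] d zeros_in_disk[of n] by (intro mult_right_mono divide_left_mono) (auto simp: z1)
      finally show "norm (norm (blaschke_factor (a n) z - 1)) \<le> 2 / d * (1 - cmod (a n))" by simp
    qed
  qed (rule compact_cball)
  then obtain l where l: "uniform_limit (cball x d) (\<lambda>N z. \<Prod>n<N. blaschke_factor (a n) z) l sequentially"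
    by (auto simp: uniformly_convergent_on_def)
  have "uniform_limit (cball x d) (\<lambda>N z. \<Prod>n<N. blaschke_factor (a n) z) \<theta> sequentially"
  proof (rule uniform_limit_cong'[THEN iffD1, OF _ _ l])
    fix z assume z: "z \<in> cball x d"
    then have "cmod z < 1" using sub' by auto
    then show "l z = \<theta> z"
      using tendsto_uniform_limitI[OF l z] partial_products_tendsto LIMSEQ_unique by blast
  qed auto
  then show "\<exists>d>0. cball x d \<subseteq> unit_disk \<and>
      uniform_limit (cball x d) (\<lambda>N z. \<Prod>n<N. blaschke_factor (a n) z) \<theta> sequentially"
    using d sub' by blast
qed auto

text \<open>
  Weierstrass' inequality \<open>1 - \<Prod>n. x n \<le> \<Sum>n. (1 - x n)\<close>, applied to the squared moduli of the
  factors.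
\<close>

lemma one_minus_theta_square_le:
  assumes z: "cmod z < 1" and "summable (\<lambda>n. (1 - (cmod (a n))\<^sup>2) / (cmod (1 - cnj (a n) * z))\<^sup>2)"
  shows "1 - (cmod (\<theta> z))\<^sup>2
    \<le> (1 - (cmod z)\<^sup>2) * (\<Sum>n. (1 - (cmod (a n))\<^sup>2) / (cmod (1 - cnj (a n) * z))\<^sup>2)"
proof -
  define P where "P n = (1 - (cmod (a n))\<^sup>2) / (cmod (1 - cnj (a n) * z))\<^sup>2" for n
  have P: "0 \<le> P n" for n using zeros_in_disk[of n] by (simp add: P_def power_le_one less_imp_le)
  have factor: "1 - (cmod (blaschke_factor (a n) z))\<^sup>2 = (1 - (cmod z)\<^sup>2) * P n" for n
    unfolding P_def using zeros_nonzero zeros_in_disk z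
    by (intro one_minus_cmod_blaschke_factor_square) (auto simp: less_imp_le)
  have "1 - (\<Sum>n<N. (1 - (cmod z)\<^sup>2) * P n) \<le> (cmod (\<Prod>n<N. blaschke_factor (a n) z))\<^sup>2" for N
  proof -
    have "1 - (\<Sum>n<N. (1 - (cmod z)\<^sup>2) * P n) \<le> (\<Prod>n<N. 1 - (1 - (cmod z)\<^sup>2) * P n)"
    proof (rule Weierstrass_prod_ineq)
      fix n
      have "0 \<le> (1 - (cmod z)\<^sup>2) * P n" using P z by (simp add: power_le_one less_imp_le)
      then show "(1 - (cmod z)\<^sup>2) * P n \<in> {0..1}" unfolding factor[symmetric] by auto
    qed
    also have "\<dots> = (cmod (\<Prod>n<N. blaschke_factor (a n) z))\<^sup>2"
      by (simp add: factor[symmetric] prod_norm[symmetric] prod_power_distrib)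
    finally show ?thesis .
  qed
  moreover have "(\<lambda>N. 1 - (\<Sum>n<N. (1 - (cmod z)\<^sup>2) * P n)) \<longlonglongrightarrow> 1 - (1 - (cmod z)\<^sup>2) * suminf P"
    using assms(2) unfolding P_def[symmetric]
    by (intro tendsto_intros) (auto simp: sums_def[symmetric] intro!: sums_mult summable_sums)
  moreover have "(\<lambda>N. (cmod (\<Prod>n<N. blaschke_factor (a n) z))\<^sup>2) \<longlonglongrightarrow> (cmod (\<theta> z))\<^sup>2"
    by (intro tendsto_intros partial_products_tendsto z)
  ultimately have "1 - (1 - (cmod z)\<^sup>2) * suminf P \<le> (cmod (\<theta> z))\<^sup>2"
    by (intro LIMSEQ_le) auto
  then show ?thesis by (simp add: P_def[abs_def])
qed

end

section \<open>Reproducing kernels\<close>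

text \<open>
  The reproducing kernel of the Hardy space at \<open>a\<close>, scaled to norm \<open>1\<close>.
\<close>

definition szego :: "complex \<Rightarrow> complex \<Rightarrow> complex" where
  "szego a z = of_real (sqrt (1 - (cmod a)\<^sup>2)) / (1 - cnj a * z)"

lemma taylor_coeff_szego:
  assumes "cmod a < 1"
  shows "taylor_coeff (szego a) n = of_real (sqrt (1 - (cmod a)\<^sup>2)) * cnj a ^ n"
proof (rule taylor_coeff_unique)
  fix z :: complex assume z: "cmod z < 1"
  have "cmod (cnj a * z) < 1"
    using assms z mult_strict_mono'[of "cmod a" 1 "cmod z" 1] by (simp add: norm_mult)
  from sums_mult[OF geometric_sums[OF this], of "of_real (sqrt (1 - (cmod a)\<^sup>2))"]
  show "(\<lambda>n. of_real (sqrt (1 - (cmod a)\<^sup>2)) * cnj a ^ n * z ^ n) sums szego a z"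
    by (simp add: szego_def power_mult_distrib mult.assoc)
qed

lemma szego_hardy2:
  assumes "cmod a < 1"
  shows "szego a \<in> hardy2"
proof -
  have "szego a holomorphic_on unit_disk"
    unfolding szego_def using one_minus_cnj_mult_nonzero[of a] assms
    by (intro holomorphic_intros) auto
  moreover have "summable (\<lambda>n. (sqrt (1 - (cmod a)\<^sup>2))\<^sup>2 * ((cmod a)\<^sup>2) ^ n)"
    using assms by (intro summable_mult summable_geometric) (simp add: power_less_one_iff)
  ultimately show ?thesis
    by (simp add: hardy2_def taylor_coeff_szego assms norm_mult norm_power power_mult_distrib
        flip: power_mult) (simp add: mult.commute)
qed

lemma szego_reproducing:
  assumes "cmod a < 1" "g holomorphic_on unit_disk"
  shows "(\<lambda>n. taylor_coeff (szego a) n * cnj (taylor_coeff g n)) sums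
    (of_real (sqrt (1 - (cmod a)\<^sup>2)) * cnj (g a))"
proof -
  have "(\<lambda>n. cnj (taylor_coeff g n * a ^ n)) sums cnj (g a)"
    by (subst sums_cnj) (rule taylor_sums[OF assms(2,1)])
  from sums_mult[OF this, of "of_real (sqrt (1 - (cmod a)\<^sup>2))"] show ?thesis
    by (simp add: taylor_coeff_szego assms(1) mult_ac)
qed

lemma h2_inner_szego:
  assumes "cmod a < 1" "cmod b < 1"
  shows "h2_inner (szego a) (szego b)
    = of_real (sqrt (1 - (cmod a)\<^sup>2)) * of_real (sqrt (1 - (cmod b)\<^sup>2)) / (1 - cnj a * b)"
  using sums_unique[OF szego_reproducing[OF assms(1) hardy2_holomorphic[OF szego_hardy2[OF assms(2)]]]]
  by (simp add: h2_inner_def szego_def mult.commute)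

text \<open>
  Pairing a kernel with \<open>\<theta> h\<close> evaluates that product at a zero of \<open>\<theta>\<close>. The pairing is computed
  from the power series, as \<open>\<theta> h\<close> is known here only to be holomorphic.
\<close>

lemma szego_combination_in_model_space:
  assumes "finite I" and a: "\<And>i. i \<in> I \<Longrightarrow> cmod (a i) < 1"
    and \<theta>: "\<theta> holomorphic_on unit_disk" "\<And>i. i \<in> I \<Longrightarrow> \<theta> (a i) = 0"
  shows "(\<lambda>z. \<Sum>i\<in>I. c i * szego (a i) z) \<in> model_space \<theta>"
proof -
  have "h2_inner (\<lambda>z. \<Sum>i\<in>I. c i * szego (a i) z) (\<lambda>z. \<theta> z * h z) = 0" if "h \<in> hardy2" for h
  proof -
    have hol: "(\<lambda>z. \<theta> z * h z) holomorphic_on unit_disk"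
      using \<theta>(1) hardy2_holomorphic[OF that] by (intro holomorphic_intros)
    have "(\<lambda>n. \<Sum>i\<in>I. c i * (taylor_coeff (szego (a i)) n * cnj (taylor_coeff (\<lambda>z. \<theta> z * h z) n)))
      sums (\<Sum>i\<in>I. c i * (of_real (sqrt (1 - (cmod (a i))\<^sup>2)) * cnj (\<theta> (a i) * h (a i))))"
      by (intro sums_sum sums_mult szego_reproducing a hol)
    moreover have "taylor_coeff (\<lambda>z. \<Sum>i\<in>I. c i * szego (a i) z) n
        = (\<Sum>i\<in>I. c i * taylor_coeff (szego (a i)) n)" for n
      using assms(1) by (rule taylor_coeff_sum) (intro hardy2_holomorphic szego_hardy2 a)
    ultimately show ?thesis
      unfolding h2_inner_def using \<theta>(2) by (simp add: sum_distrib_right mult.assoc sums_iff)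
  qed
  then show ?thesis
    unfolding model_space_def using assms by (auto intro!: hardy2_sum szego_hardy2)
qed

text \<open>
  The composed kernel is again a multiple of some \<open>1 / (p - q z)\<close>, whose squared norm is the
  geometric sum \<open>1 / (|p|\<^sup>2 - |q|\<^sup>2)\<close>; here that difference collapses to \<open>1 - Re a\<close>.
\<close>

lemma szego_compose_half_norm:
  assumes a: "cmod a < 1"
  shows "(h2_norm (\<lambda>z. szego a ((1 + z) / 2)))\<^sup>2 = (1 - (cmod a)\<^sup>2) / (1 - Re a)"
proof -
  define p where "p = 1 - cnj a / 2"
  define q where "q = cnj a / 2"
  define s where "s = sqrt (1 - (cmod a)\<^sup>2)"
  have s2: "s\<^sup>2 = 1 - (cmod a)\<^sup>2" using a by (simp add: s_def power_le_one)
  have p: "cmod p > 1 / 2"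
    using norm_triangle_ineq2[of 1 "cnj a / 2"] a by (simp add: p_def norm_divide)
  have q: "cmod q < 1 / 2" using a by (simp add: q_def norm_divide)
  have p0: "p \<noteq> 0" using p by auto
  have qp: "cmod (q / p) < 1" using p q by (simp add: norm_divide divide_less_eq)
  have coeff: "taylor_coeff (\<lambda>z. szego a ((1 + z) / 2)) n = of_real s / p * (q / p) ^ n" for n
  proof (rule taylor_coeff_unique)
    fix z :: complex assume z: "cmod z < 1"
    have "cmod (q / p * z) < 1"
      using qp z mult_strict_mono'[of "cmod (q / p)" 1 "cmod z" 1]
      by (simp only: norm_mult mult_1 norm_ge_zero simp_thms)
    from sums_mult[OF geometric_sums[OF this], of "of_real s / p"]
    have "(\<lambda>n. of_real s / p * (q / p) ^ n * z ^ n) sums (of_real s / p * (1 / (1 - q / p * z)))"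
      by (simp only: power_mult_distrib mult.assoc)
    also have "of_real s / p * (1 / (1 - q / p * z)) = of_real s / (p * (1 - q / p * z))"
      by simp
    also have "p * (1 - q / p * z) = 1 - cnj a * ((1 + z) / 2)"
      using p0 by (simp add: right_diff_distrib) (simp add: p_def q_def field_simps)
    finally show "(\<lambda>n. of_real s / p * (q / p) ^ n * z ^ n) sums szego a ((1 + z) / 2)"
      by (simp add: szego_def s_def)
  qed
  have hardy: "(\<lambda>z. szego a ((1 + z) / 2)) \<in> hardy2"
    by (rule hardy2_compose_half(1)[OF szego_hardy2[OF a]])
  have "(\<lambda>n. (s\<^sup>2 / (cmod p)\<^sup>2) * ((cmod (q / p))\<^sup>2) ^ n) sums
      ((s\<^sup>2 / (cmod p)\<^sup>2) * (1 / (1 - (cmod (q / p))\<^sup>2)))"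
    using qp by (intro sums_mult geometric_sums) (simp add: power_less_one_iff)
  moreover have "(cmod (taylor_coeff (\<lambda>z. szego a ((1 + z) / 2)) n))\<^sup>2
      = (s\<^sup>2 / (cmod p)\<^sup>2) * ((cmod (q / p))\<^sup>2) ^ n" for n
    unfolding coeff
    by (simp add: norm_mult norm_divide norm_power power_mult_distrib power_divide
        flip: power_mult) (simp add: mult.commute)
  ultimately have "(h2_norm (\<lambda>z. szego a ((1 + z) / 2)))\<^sup>2
      = (s\<^sup>2 / (cmod p)\<^sup>2) * (1 / (1 - (cmod (q / p))\<^sup>2))"
    using h2_norm_square_sums[OF hardy] by (simp add: sums_iff)
  also have "\<dots> = s\<^sup>2 / ((cmod p)\<^sup>2 - (cmod q)\<^sup>2)"
    using p0 by (simp add: norm_divide power_divide right_diff_distrib)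
  also have "(cmod p)\<^sup>2 - (cmod q)\<^sup>2 = 1 - Re a"
    unfolding cmod_power2 by (simp add: p_def q_def power2_eq_square field_simps)
  finally show ?thesis by (simp add: s2)
qed

lemma h2_inner_commute:
  assumes "f \<in> hardy2" "g \<in> hardy2"
  shows "h2_inner g f = cnj (h2_inner f g)"
proof -
  have "(\<lambda>n. cnj (taylor_coeff f n * cnj (taylor_coeff g n))) sums cnj (h2_inner f g)"
    by (subst sums_cnj) (rule h2_inner_sums[OF assms])
  then show ?thesis by (simp add: h2_inner_def[of g f] sums_iff mult.commute)
qed

text \<open>Schur's test for the Gram matrix: since it is Hermitian, its row sums suffice.\<close>

lemma gram_bessel:
  assumes I: "finite I" and \<kappa>: "\<And>i. i \<in> I \<Longrightarrow> \<kappa> i \<in> hardy2"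
    and row: "\<And>i. i \<in> I \<Longrightarrow> (\<Sum>j\<in>I. cmod (h2_inner (\<kappa> i) (\<kappa> j))) \<le> B"
  shows "(h2_norm (\<lambda>z. \<Sum>i\<in>I. c i * \<kappa> i z))\<^sup>2 \<le> B * (\<Sum>i\<in>I. (cmod (c i))\<^sup>2)"
proof -
  let ?f = "\<lambda>z. \<Sum>i\<in>I. c i * \<kappa> i z"
  define G where "G i j = cmod (h2_inner (\<kappa> i) (\<kappa> j))" for i j
  have G_commute: "G i j = G j i" if "i \<in> I" "j \<in> I" for i j
    using h2_inner_commute[OF \<kappa>[OF that(1)] \<kappa>[OF that(2)]] by (simp add: G_def)
  have self: "h2_inner ?f ?f = complex_of_real ((h2_norm ?f)\<^sup>2)"
    by (intro h2_inner_self_norm hardy2_sum I \<kappa>)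
  have "(h2_norm ?f)\<^sup>2 = cmod (h2_inner ?f ?f)"
    unfolding self norm_of_real by simp
  also have "h2_inner ?f ?f = (\<Sum>i\<in>I. \<Sum>j\<in>I. c i * cnj (c j) * h2_inner (\<kappa> i) (\<kappa> j))"
    by (rule h2_inner_sum_sum[OF I \<kappa>])
  also have "cmod \<dots> \<le> (\<Sum>i\<in>I. \<Sum>j\<in>I. cmod (c i) * cmod (c j) * G i j)"
    by (intro sum_norm_le order_trans[OF norm_sum] sum_mono) (simp add: norm_mult G_def)
  also have "\<dots> \<le> (\<Sum>i\<in>I. \<Sum>j\<in>I. ((cmod (c i))\<^sup>2 * G i j + (cmod (c j))\<^sup>2 * G i j) / 2)"
  proof (intro sum_mono)
    fix i j
    have "cmod (c i) * cmod (c j) \<le> ((cmod (c i))\<^sup>2 + (cmod (c j))\<^sup>2) / 2"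
      using sum_squares_bound[of "cmod (c i)" "cmod (c j)"] by simp
    then have "cmod (c i) * cmod (c j) * G i j \<le> ((cmod (c i))\<^sup>2 + (cmod (c j))\<^sup>2) / 2 * G i j"
      by (intro mult_right_mono) (auto simp: G_def)
    then show "cmod (c i) * cmod (c j) * G i j
        \<le> ((cmod (c i))\<^sup>2 * G i j + (cmod (c j))\<^sup>2 * G i j) / 2"
      by (simp add: algebra_simps)
  qed
  also have "\<dots> = ((\<Sum>i\<in>I. \<Sum>j\<in>I. (cmod (c i))\<^sup>2 * G i j) + (\<Sum>i\<in>I. \<Sum>j\<in>I. (cmod (c j))\<^sup>2 * G i j)) / 2"
    by (simp add: sum.distrib sum_divide_distrib[symmetric])
  also have "(\<Sum>i\<in>I. \<Sum>j\<in>I. (cmod (c j))\<^sup>2 * G i j) = (\<Sum>i\<in>I. \<Sum>j\<in>I. (cmod (c i))\<^sup>2 * G i j)"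
    by (subst sum.swap) (intro sum.cong refl, simp add: G_commute)
  also have "((\<Sum>i\<in>I. \<Sum>j\<in>I. (cmod (c i))\<^sup>2 * G i j) + (\<Sum>i\<in>I. \<Sum>j\<in>I. (cmod (c i))\<^sup>2 * G i j)) / 2
      = (\<Sum>i\<in>I. (cmod (c i))\<^sup>2 * (\<Sum>j\<in>I. G i j))"
  proof -
    have "(x + x) / 2 = x" for x :: real by simp
    then show ?thesis by (simp only: sum_distrib_left)
  qed
  also have "\<dots> \<le> (\<Sum>i\<in>I. (cmod (c i))\<^sup>2 * B)"
    using row by (intro sum_mono mult_left_mono) (auto simp: G_def)
  finally show ?thesis by (simp add: sum_distrib_left mult.commute)
qed

section \<open>The zeros\<close>

text \<open>
  The zeros \<open>z\<^sub>n\<close>, with \<open>n \<ge> 1\<close> in all that follows: the division by \<open>n\<close> makes the index \<open>0\<close>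
  degenerate.
\<close>

definition bl_radius :: "nat \<Rightarrow> real" where
  "bl_radius n = 1 - 1 / real n * (1 / 2 ^ (2 * n))"

definition bl_zero :: "nat \<Rightarrow> complex" where
  "bl_zero n = of_real (bl_radius n) * exp (\<i> * of_real (1 / 2 ^ n))"

lemma bl_radius_altdef: "bl_radius n = 1 - (1 / 2 ^ n)\<^sup>2 / real n"
  by (simp add: bl_radius_def power_even_eq power_divide)

lemma half_power_square_le:
  assumes "n \<ge> 1"
  shows "(1 / 2 ^ n :: real)\<^sup>2 \<le> 1 / 4" "(1 / 2 ^ n :: real) \<le> 1 / 2"
proof -
  have "(2::real) ^ 1 \<le> 2 ^ n" using assms by (intro power_increasing) auto
  then show *: "(1 / 2 ^ n :: real) \<le> 1 / 2" by (simp add: field_simps)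
  from power_mono[OF this, of 2] show "(1 / 2 ^ n :: real)\<^sup>2 \<le> 1 / 4" by (simp add: power_divide)
qed

lemma bl_radius_bounds:
  assumes "n \<ge> 1"
  shows "3 / 4 \<le> bl_radius n" "bl_radius n < 1"
proof -
  have "(1 / 2 ^ n)\<^sup>2 / real n \<le> (1 / 4) / 1"
    using assms half_power_square_le(1) by (intro frac_le) auto
  then show "3 / 4 \<le> bl_radius n" by (simp add: bl_radius_altdef)
  show "bl_radius n < 1" using assms by (simp add: bl_radius_def)
qed

lemma cmod_bl_zero:
  assumes "n \<ge> 1"
  shows "cmod (bl_zero n) = bl_radius n"
  using bl_radius_bounds[OF assms] by (simp add: bl_zero_def norm_mult)

lemma bl_zero_in_disk: "n \<ge> 1 \<Longrightarrow> cmod (bl_zero n) < 1"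
  using bl_radius_bounds by (simp add: cmod_bl_zero)

lemma Re_bl_zero: "Re (bl_zero n) = bl_radius n * cos (1 / 2 ^ n)"
  and Im_bl_zero: "Im (bl_zero n) = bl_radius n * sin (1 / 2 ^ n)"
proof -
  have "bl_zero n = of_real (bl_radius n) * cis (1 / 2 ^ n)"
    by (simp only: bl_zero_def cis_conv_exp)
  then show "Re (bl_zero n) = bl_radius n * cos (1 / 2 ^ n)"
    "Im (bl_zero n) = bl_radius n * sin (1 / 2 ^ n)"
    by simp_all
qed

lemma one_minus_bl_zero_square:
  assumes "n \<ge> 1"
  shows "(1 / 2 ^ n)\<^sup>2 / real n \<le> 1 - (cmod (bl_zero n))\<^sup>2"
    and "1 - (cmod (bl_zero n))\<^sup>2 \<le> 2 * ((1 / 2 ^ n)\<^sup>2 / real n)"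
proof -
  let ?r = "bl_radius n"
  have d: "(1 / 2 ^ n)\<^sup>2 / real n = 1 - ?r" by (simp add: bl_radius_altdef)
  have eq: "1 - (cmod (bl_zero n))\<^sup>2 = (1 - ?r) * (1 + ?r)"
    using assms by (simp add: cmod_bl_zero power2_eq_square algebra_simps)
  have r: "0 \<le> ?r" "?r \<le> 1" using bl_radius_bounds[OF assms] by auto
  have "(1 - ?r) * 1 \<le> (1 - ?r) * (1 + ?r)" "(1 - ?r) * (1 + ?r) \<le> (1 - ?r) * 2"
    using r by (intro mult_left_mono; simp)+
  then show "(1 / 2 ^ n)\<^sup>2 / real n \<le> 1 - (cmod (bl_zero n))\<^sup>2"
    "1 - (cmod (bl_zero n))\<^sup>2 \<le> 2 * ((1 / 2 ^ n)\<^sup>2 / real n)"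
    unfolding d eq by auto
qed

lemma Im_bl_zero_bounds:
  assumes "n \<ge> 1"
  shows "13 / 20 * (1 / 2 ^ n) \<le> Im (bl_zero n)" "Im (bl_zero n) \<le> 1 / 2 ^ n"
proof -
  define x :: real where "x = 1 / 2 ^ n"
  have x: "0 < x" "x \<le> 1 / 2" using half_power_square_le(2)[OF assms] by (auto simp: x_def)
  have x2: "x\<^sup>2 \<le> 1 / 4" using half_power_square_le(1)[OF assms] by (simp add: x_def)
  have r: "3 / 4 \<le> bl_radius n" "bl_radius n < 1" by (rule bl_radius_bounds[OF assms])+
  have "\<bar>sin x - (\<Sum>m<3. sin_coeff m * x ^ m)\<bar> \<le> inverse (fact 3) * \<bar>x\<bar> ^ 3"
    by (rule Maclaurin_sin_bound)
  moreover have "(\<Sum>m<3. sin_coeff m * x ^ m) = x"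
    by (simp add: numeral_3_eq_3 sin_coeff_def)
  moreover have "inverse (fact 3) * \<bar>x\<bar> ^ 3 \<le> x / 24"
  proof -
    have "x\<^sup>2 * x \<le> 1 / 4 * x" using x x2 by (intro mult_right_mono) auto
    then show ?thesis using x by (simp add: fact_numeral power3_eq_cube power2_eq_square)
  qed
  ultimately have s: "23 / 24 * x \<le> sin x" by linarith
  have "13 / 20 * x \<le> 3 / 4 * (23 / 24 * x)" using x by simp
  also have "\<dots> \<le> bl_radius n * sin x" using s r x by (intro mult_mono) auto
  finally show "13 / 20 * (1 / 2 ^ n) \<le> Im (bl_zero n)" by (simp add: Im_bl_zero x_def)
  have "bl_radius n * sin x \<le> 1 * x"
    using r x s sin_x_le_x[of x] by (intro mult_mono) auto
  then show "Im (bl_zero n) \<le> 1 / 2 ^ n" by (simp add: Im_bl_zero x_def)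
qed

text \<open>
  Here and in the disjointness argument below it matters that the lower bound for \<open>Im (bl_zero
  n)\<close> exceeds half of the upper one.
\<close>

lemma Im_bl_zero_gap:
  assumes "1 \<le> n" "n < m"
  shows "3 / 20 * (1 / 2 ^ n) \<le> Im (bl_zero n) - Im (bl_zero m)"
proof -
  have "(2::real) ^ Suc n \<le> 2 ^ m" using assms by (intro power_increasing) auto
  then have "(1 / 2 ^ m :: real) \<le> 1 / 2 * (1 / 2 ^ n)" by (simp add: field_simps)
  then show ?thesis
    using Im_bl_zero_bounds(1)[OF assms(1)] Im_bl_zero_bounds(2)[of m] assms by simp
qed

lemma one_minus_Re_bl_zero_le:
  assumes "n \<ge> 1"
  shows "1 - Re (bl_zero n) \<le> 3 / 2 * (1 / 2 ^ n)\<^sup>2"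
proof -
  define x :: real where "x = 1 / 2 ^ n"
  have x: "0 < x" by (simp add: x_def)
  have r: "0 \<le> bl_radius n" "bl_radius n \<le> 1" using bl_radius_bounds[OF assms] by auto
  have "cos x = 1 - 2 * (sin (x / 2))\<^sup>2" using cos_double_sin[of "x / 2"] by simp
  moreover have "(sin (x / 2))\<^sup>2 \<le> (x / 2)\<^sup>2"
    using abs_sin_x_le_abs_x[of "x / 2"] x by (simp add: abs_le_square_iff[symmetric])
  ultimately have c: "1 - cos x \<le> x\<^sup>2 / 2" by (simp add: power_divide)
  have "1 - Re (bl_zero n) = (1 - bl_radius n) + bl_radius n * (1 - cos x)"
    by (simp add: Re_bl_zero x_def algebra_simps)
  also have "bl_radius n * (1 - cos x) \<le> 1 * (1 - cos x)"
    using r by (intro mult_right_mono) auto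
  also have "1 - bl_radius n \<le> x\<^sup>2"
    using assms by (simp add: bl_radius_altdef x_def field_simps)
  finally show ?thesis using c by (simp add: x_def)
qed

section \<open>Failure of the Hilbert--Schmidt property\<close>

text \<open>
  The numerator \<open>sqrt (1 - |z\<^sub>n|\<^sup>2) sqrt (1 - |z\<^sub>m|\<^sup>2)\<close> of the inner product is of order \<open>2 ^
  -(n + m)\<close>, while the denominator is at least the distance of the zeros, which is of order \<open>2
  ^ -n\<close>. What remains decays geometrically, so the Gram matrix has bounded row sums.
\<close>

lemma szego_bl_zero_inner_less:
  assumes "1 \<le> n" "n < m"
  shows "cmod (h2_inner (szego (bl_zero n)) (szego (bl_zero m))) \<le> 14 * (1 / 2 ^ m)"
    and "cmod (h2_inner (szego (bl_zero m)) (szego (bl_zero n))) \<le> 14 * (1 / 2 ^ m)"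
proof -
  define N M D where "N = sqrt (1 - (cmod (bl_zero n))\<^sup>2)" and "M = sqrt (1 - (cmod (bl_zero m))\<^sup>2)"
    and "D = cmod (1 - cnj (bl_zero n) * bl_zero m)"
  have disk: "cmod (bl_zero n) < 1" "cmod (bl_zero m) < 1" using assms by (auto intro: bl_zero_in_disk)
  have "3 / 20 * (1 / 2 ^ n) \<le> \<bar>Im (bl_zero m - bl_zero n)\<bar>"
    using Im_bl_zero_gap[OF assms] by simp
  also have "\<dots> \<le> cmod (bl_zero m - bl_zero n)" by (rule abs_Im_le_cmod)
  also have "\<dots> \<le> D"
    unfolding D_def using disk by (intro cmod_diff_le_one_minus_cnj_mult) auto
  finally have D: "3 / 20 * (1 / 2 ^ n) \<le> D" .
  have sqrt_le: "sqrt (1 - (cmod (bl_zero k))\<^sup>2) \<le> sqrt 2 * (1 / 2 ^ k)" if "k \<ge> 1" for k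
  proof -
    have "(1 / 2 ^ k)\<^sup>2 / real k \<le> (1 / 2 ^ k)\<^sup>2" using that by (simp add: divide_le_eq)
    then have "1 - (cmod (bl_zero k))\<^sup>2 \<le> 2 * (1 / 2 ^ k)\<^sup>2"
      using one_minus_bl_zero_square(2)[OF that] by linarith
    then have "sqrt (1 - (cmod (bl_zero k))\<^sup>2) \<le> sqrt (2 * (1 / 2 ^ k)\<^sup>2)"
      by (rule real_sqrt_le_mono)
    then show ?thesis by (simp add: real_sqrt_mult)
  qed
  have NM0: "0 \<le> N" "0 \<le> M" using disk by (auto simp: N_def M_def power_le_one)
  have "N * M \<le> (sqrt 2 * (1 / 2 ^ n)) * (sqrt 2 * (1 / 2 ^ m))"
    unfolding N_def M_def using assms NM0 by (intro mult_mono sqrt_le) (auto simp: M_def)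
  also have "\<dots> = (1 / 2 ^ n) * (2 * (1 / 2 ^ m))"
    using real_sqrt_mult_self[of 2] by (simp add: field_simps)
  finally have "N * M / D \<le> ((1 / 2 ^ n) * (2 * (1 / 2 ^ m))) / (3 / 20 * (1 / 2 ^ n))"
    using D NM0 by (intro frac_le) auto
  also have "\<dots> = 40 / 3 * (1 / 2 ^ m)" by simp
  also have "\<dots> \<le> 14 * (1 / 2 ^ m)" by (intro mult_right_mono) auto
  finally have le: "N * M / D \<le> 14 * (1 / 2 ^ m)" .
  have eq: "cmod (h2_inner (szego (bl_zero n)) (szego (bl_zero m))) = N * M / D"
    using NM0 by (simp add: h2_inner_szego disk norm_mult norm_divide N_def M_def D_def del: of_real_power)
  then show "cmod (h2_inner (szego (bl_zero n)) (szego (bl_zero m))) \<le> 14 * (1 / 2 ^ m)"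
    using le by simp
  then show "cmod (h2_inner (szego (bl_zero m)) (szego (bl_zero n))) \<le> 14 * (1 / 2 ^ m)"
    using h2_inner_commute[OF szego_hardy2[OF disk(1)] szego_hardy2[OF disk(2)]] by simp
qed

lemma szego_bl_zero_row:
  assumes "n \<in> {1..N}"
  shows "(\<Sum>m\<in>{1..N}. cmod (h2_inner (szego (bl_zero n)) (szego (bl_zero m)))) \<le> 15"
proof -
  have n: "1 \<le> n" using assms by simp
  have diag: "cmod (h2_inner (szego (bl_zero n)) (szego (bl_zero n))) = 1"
  proof -
    have "1 - (cmod (bl_zero n))\<^sup>2 > 0"
      using bl_zero_in_disk[OF n] by (simp add: power_less_one_iff)
    moreover have "1 - cnj (bl_zero n) * bl_zero n = of_real (1 - (cmod (bl_zero n))\<^sup>2)"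
      using complex_norm_square[of "bl_zero n"] by (simp add: mult.commute)
    moreover have "complex_of_real (sqrt (1 - (cmod (bl_zero n))\<^sup>2)) * of_real (sqrt (1 - (cmod (bl_zero n))\<^sup>2))
        = of_real (1 - (cmod (bl_zero n))\<^sup>2)"
      using calculation(1) by (simp only: of_real_mult[symmetric] real_sqrt_mult_self) simp
    ultimately have "h2_inner (szego (bl_zero n)) (szego (bl_zero n)) = 1"
      by (simp only: h2_inner_szego bl_zero_in_disk[OF n]) (metis divide_self less_irrefl of_real_eq_0_iff)
    then show ?thesis by simp
  qed
  have off: "cmod (h2_inner (szego (bl_zero n)) (szego (bl_zero m))) \<le> 14 * (1 / 2) ^ m"
    if "m \<in> {1..N} - {n}" for m
  proof (cases "n < m")
    case True
    then show ?thesis using szego_bl_zero_inner_less(1)[OF n True] by (simp add: power_divide)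
  next
    case False
    then have m: "1 \<le> m" "m < n" using that by auto
    have "(2::real) ^ m \<le> 2 ^ n" using m by (intro power_increasing) auto
    then have "(1 / 2 ^ n :: real) \<le> 1 / 2 ^ m" by (simp add: field_simps)
    then show ?thesis using szego_bl_zero_inner_less(2)[OF m] by (simp add: power_divide)
  qed
  have "(\<Sum>m\<in>{1..N}. cmod (h2_inner (szego (bl_zero n)) (szego (bl_zero m))))
      = 1 + (\<Sum>m\<in>{1..N} - {n}. cmod (h2_inner (szego (bl_zero n)) (szego (bl_zero m))))"
    by (subst sum.remove[OF _ assms]) (auto simp: diag)
  also have "(\<Sum>m\<in>{1..N} - {n}. cmod (h2_inner (szego (bl_zero n)) (szego (bl_zero m))))
      \<le> (\<Sum>m\<in>{1..N} - {n}. 14 * (1 / 2) ^ m)"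
    by (intro sum_mono off)
  also have "\<dots> \<le> (\<Sum>m\<in>{1..N}. 14 * (1 / 2) ^ m)"
    by (intro sum_mono2) auto
  also have "\<dots> = 14 * (\<Sum>m\<in>{1..N}. (1 / 2) ^ m)" by (simp add: sum_distrib_left)
  also have "(\<Sum>m\<in>{1..N}. (1 / 2 :: real) ^ m) \<le> 1"
  proof -
    have "(\<Sum>m\<in>{1..N}. (1 / 2 :: real) ^ m) = 1 - (1 / 2) ^ N" by (induction N) auto
    then show ?thesis by simp
  qed
  finally show ?thesis by simp
qed

text \<open>
  The unit vectors \<open>szego z\<^sub>n\<close> lie in the model space and form a Bessel sequence, so a
  Hilbert--Schmidt operator would have square-summable images on them. But their images have
  squared norm \<open>(1 - |z\<^sub>n|\<^sup>2) / (1 - Re z\<^sub>n)\<close>, where numerator and denominator are of order \<open>4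
  ^ -n / n\<close> and \<open>4 ^ -n\<close>: their sum diverges like the harmonic series.
\<close>

lemma composition_op_half_not_hilbert_schmidt:
  assumes \<phi>: "\<And>z. z \<in> unit_disk \<Longrightarrow> \<phi> z = (1 + z) / 2"
    and hol: "\<theta> holomorphic_on unit_disk" and zeros: "\<And>n. n \<ge> 1 \<Longrightarrow> \<theta> (bl_zero n) = 0"
  shows "\<not> hilbert_schmidt_h2 (model_space \<theta>) (composition_op \<phi>)"
proof
  define T where "T = composition_op \<phi>"
  assume "hilbert_schmidt_h2 (model_space \<theta>) (composition_op \<phi>)"
  then obtain E where E: "orthonormal_basis_of (model_space \<theta>) E"
    and summable_E: "(\<lambda>e. (h2_norm (T e))\<^sup>2) summable_on E"
    by (auto simp: hilbert_schmidt_h2_def T_def)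
  define S where "S = (\<Sum>\<^sub>\<infinity>e\<in>E. (h2_norm (T e))\<^sup>2)"
  have bessel: "(\<Sum>n\<in>{1..N}. (h2_norm (T (szego (bl_zero n))))\<^sup>2) \<le> 15 * S" for N
    unfolding S_def T_def
  proof (rule hilbert_schmidt_bessel[OF _ _ _ E, where C = "sqrt 2"], fold T_def)
    show "(\<lambda>z. \<Sum>n\<in>{1..N}. c n * szego (bl_zero n) z) \<in> model_space \<theta>" for c
      using zeros by (intro szego_combination_in_model_space hol) (auto intro: bl_zero_in_disk)
    show "(h2_norm (\<lambda>z. \<Sum>n\<in>{1..N}. c n * szego (bl_zero n) z))\<^sup>2 \<le> 15 * (\<Sum>n\<in>{1..N}. (cmod (c n))\<^sup>2)" for c
      by (intro gram_bessel szego_bl_zero_row szego_hardy2 bl_zero_in_disk) auto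
    show "model_space \<theta> \<subseteq> hardy2" using model_space_hardy2 by blast
    show "szego (bl_zero n) \<in> hardy2" if "n \<in> {1..N}" for n
      using that by (intro szego_hardy2 bl_zero_in_disk) auto
  qed (use summable_E in \<open>auto simp: T_def intro: composition_op_half_hardy2[OF \<phi>]
      composition_op_half_bounded[OF \<phi>]\<close>)
  have harmonic: "2 / 3 * inverse (real n) \<le> (h2_norm (T (szego (bl_zero n))))\<^sup>2" if n: "n \<ge> 1" for n
  proof -
    have Re: "Re (bl_zero n) < 1"
      using bl_zero_in_disk[OF n] complex_Re_le_cmod[of "bl_zero n"] by linarith
    have "2 / 3 * inverse (real n) = ((1 / 2 ^ n)\<^sup>2 / real n) / (3 / 2 * (1 / 2 ^ n)\<^sup>2)"
      by (simp add: field_simps)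
    also have "\<dots> \<le> (1 - (cmod (bl_zero n))\<^sup>2) / (1 - Re (bl_zero n))"
      using one_minus_bl_zero_square(1)[OF n] one_minus_Re_bl_zero_le[OF n] Re
        bl_zero_in_disk[OF n] by (intro frac_le) (auto simp: power_le_one)
    also have "\<dots> = (h2_norm (T (szego (bl_zero n))))\<^sup>2"
      using composition_op_half_norm[of \<phi> "szego (bl_zero n)"] \<phi>
      by (simp add: T_def szego_compose_half_norm[OF bl_zero_in_disk[OF n]])
    finally show ?thesis .
  qed
  have "(\<Sum>n<N. inverse (real n)) \<le> 3 / 2 * (15 * S)" for N
  proof -
    have "2 / 3 * (\<Sum>n<N. inverse (real n)) = (\<Sum>n\<in>{1..<N}. 2 / 3 * inverse (real n))"
      unfolding sum_distrib_left by (rule sum.mono_neutral_right) auto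
    also have "\<dots> \<le> (\<Sum>n\<in>{1..<N}. (h2_norm (T (szego (bl_zero n))))\<^sup>2)"
      by (intro sum_mono harmonic) auto
    also have "\<dots> \<le> (\<Sum>n\<in>{1..N}. (h2_norm (T (szego (bl_zero n))))\<^sup>2)"
      by (intro sum_mono2) auto
    also have "\<dots> \<le> 15 * S" by (rule bessel)
    finally show ?thesis by simp
  qed
  then have "summable (\<lambda>n. inverse (real n))"
    by (rule summableI_nonneg_bounded[rotated]) simp
  then show False using not_summable_harmonic[where 'a = real] by simp
qed

section \<open>Integrals over the plane\<close>

lemma nn_integral_complex_product:
  fixes f g :: "real \<Rightarrow> ennreal"
  assumes [measurable]: "f \<in> borel_measurable borel" "g \<in> borel_measurable borel"
  shows "(\<integral>\<^sup>+ z. f (Re z) * g (Im z) \<partial>lborel) = (\<integral>\<^sup>+ x. f x \<partial>lborel) * (\<integral>\<^sup>+ y. g y \<partial>lborel)"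
proof -
  define h where "h b = (if b = 1 then f else g)" for b :: complex
  have "h b \<in> borel_measurable borel" for b by (simp add: h_def)
  then have "(\<integral>\<^sup>+ z. (\<Prod>b\<in>Basis. h b (z \<bullet> b)) \<partial>lborel) = (\<Prod>b\<in>Basis. (\<integral>\<^sup>+ x. h b x \<partial>lborel))"
    by (intro nn_integral_lborel_prod) auto
  then show ?thesis by (simp add: Basis_complex_def h_def inner_complex_def)
qed

text \<open>
  The function \<open>t ^ (-1/2)\<close> on the unit interval, with the value \<open>\<infinity>\<close> at \<open>0\<close>: a majorant built
  from it covers the pole of the counting function at \<open>1 / 2\<close> without an exceptional null set.
\<close>

definition inv_sqrt :: "real \<Rightarrow> ennreal" where
  "inv_sqrt t = inverse (ennreal (sqrt t)) * indicator {0..1} t"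

lemma measurable_inv_sqrt[measurable]: "inv_sqrt \<in> borel_measurable borel"
  unfolding inv_sqrt_def by measurable

lemma nn_integral_inv_sqrt: "(\<integral>\<^sup>+ t. inv_sqrt t \<partial>lborel) < \<infinity>"
proof -
  define f where "f t = (if t \<in> {0..1} then t powr (-1/2) else 0)" for t :: real
  have "((\<lambda>t::real. t powr (-1/2)) has_integral (1 powr (-1/2 + 1) / (-1/2 + 1))) {0..1}"
    by (rule has_integral_powr_from_0) auto
  then have "(f has_integral 2) UNIV"
    unfolding f_def has_integral_restrict_UNIV by simp
  moreover have f_nonneg: "0 \<le> f t" for t by (simp add: f_def)
  moreover have "f \<in> borel_measurable borel" unfolding f_def by measurable
  ultimately have "(\<integral>\<^sup>+ t. ennreal (f t) \<partial>lborel) = ennreal 2"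
    using f_nonneg by (intro nn_integral_has_integral_lborel)
  moreover have "(\<integral>\<^sup>+ t. inv_sqrt t \<partial>lborel) = (\<integral>\<^sup>+ t. ennreal (f t) \<partial>lborel)"
  proof (rule nn_integral_cong_AE)
    have "AE t in lborel. t \<noteq> (0::real)" by (rule AE_lborel_singleton)
    then show "AE t in lborel. inv_sqrt t = ennreal (f t)"
    proof eventually_elim
      case (elim t)
      show ?case
      proof (cases "t \<in> {0..1}")
        case True
        then have "t > 0" using elim by auto
        then show ?thesis
          using True by (simp add: inv_sqrt_def f_def inverse_ennreal powr_half_sqrt[symmetric] powr_minus)
      qed (auto simp: inv_sqrt_def f_def)
    qed
  qed
  ultimately show ?thesis by simp
qed

lemma nn_integral_inv_sqrt_affine:
  assumes "c \<noteq> 0"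
  shows "(\<integral>\<^sup>+ x. inv_sqrt (t + c * x) \<partial>lborel) < \<infinity>"
proof (rule ccontr)
  assume "\<not> ?thesis"
  then have "(\<integral>\<^sup>+ x. inv_sqrt (t + c * x) \<partial>lborel) = \<infinity>" by (simp add: less_top[symmetric])
  then have "(\<integral>\<^sup>+ t. inv_sqrt t \<partial>lborel) = \<infinity>"
    using nn_integral_real_affine[OF measurable_inv_sqrt assms, of t] assms
    by (simp add: ennreal_mult_eq_top_iff)
  then show False using nn_integral_inv_sqrt by simp
qed

lemma nn_integral_inverse_cube:
  assumes "\<epsilon> > 0"
  shows "(\<integral>\<^sup>+ x. ennreal (1 / (1 - x) ^ 3) * indicator {0..1 - \<epsilon>} x \<partial>lborel) \<le> ennreal (1 / (2 * \<epsilon>\<^sup>2))"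
proof (cases "\<epsilon> \<le> 1")
  case True
  have "(\<integral>\<^sup>+ x. ennreal (1 / (1 - x) ^ 3) * indicator {0..1 - \<epsilon>} x \<partial>lborel)
      = ennreal (1 / (2 * (1 - (1 - \<epsilon>))\<^sup>2) - 1 / (2 * (1 - 0)\<^sup>2))"
  proof (rule nn_integral_FTC_Icc)
    fix x assume x: "x \<in> {0..1 - \<epsilon>}"
    then have x1: "x < 1" using assms by auto
    have "((\<lambda>t::real. 1 / (2 * t\<^sup>2)) has_real_derivative - (1 / t ^ 3)) (at t)" if "t \<noteq> 0" for t
      using that by (auto intro!: derivative_eq_intros simp: field_simps eval_nat_numeral)
    moreover have "((\<lambda>x. 1 - x) has_real_derivative - 1) (at x)"
      by (auto intro!: derivative_eq_intros)
    ultimately have "((\<lambda>x. 1 / (2 * (1 - x)\<^sup>2)) has_real_derivative - (1 / (1 - x) ^ 3) * - 1)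
        (at x)"
      using x1 by (intro DERIV_chain2) auto
    then show "((\<lambda>x. 1 / (2 * (1 - x)\<^sup>2)) has_real_derivative 1 / (1 - x) ^ 3) (at x)"
      by simp
    show "0 \<le> 1 / (1 - x) ^ 3" using x1 by simp
  qed (use True in auto)
  also have "\<dots> \<le> ennreal (1 / (2 * \<epsilon>\<^sup>2))" by (intro ennreal_leI) simp
  finally show ?thesis .
next
  case False
  then have "{0..1 - \<epsilon>} = {}" by auto
  then show ?thesis by simp
qed

lemma nn_integral_poisson:
  assumes "\<epsilon> > 0" "w \<ge> 0"
  shows "(\<integral>\<^sup>+ y. ennreal (1 / (\<epsilon>\<^sup>2 + (y - b)\<^sup>2)) * indicator {b - w..b + w} y \<partial>lborel) \<le> ennreal (4 / \<epsilon>)"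
proof -
  have pos: "\<epsilon>\<^sup>2 + (y - b)\<^sup>2 > 0" for y using assms by (intro add_pos_nonneg) auto
  have "(\<integral>\<^sup>+ y. ennreal (1 / (\<epsilon>\<^sup>2 + (y - b)\<^sup>2)) * indicator {b - w..b + w} y \<partial>lborel)
      = ennreal (arctan ((b + w - b) / \<epsilon>) / \<epsilon> - arctan ((b - w - b) / \<epsilon>) / \<epsilon>)"
  proof (rule nn_integral_FTC_Icc)
    fix y
    have "\<epsilon> * (1 + ((y - b) / \<epsilon>)\<^sup>2) * \<epsilon> = \<epsilon>\<^sup>2 + (y - b)\<^sup>2"
      using assms by (simp add: power_divide power2_eq_square field_simps)
    then have eq: "inverse (1 + ((y - b) / \<epsilon>)\<^sup>2) * (1 / \<epsilon>) / \<epsilon> = 1 / (\<epsilon>\<^sup>2 + (y - b)\<^sup>2)"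
      by (metis divide_divide_eq_left inverse_eq_divide mult.commute mult.left_commute times_divide_eq_left mult_1)
    have "((\<lambda>y. (y - b) / \<epsilon>) has_real_derivative 1 / \<epsilon>) (at y)"
      using assms by (auto intro!: derivative_eq_intros)
    from DERIV_cdivide[OF DERIV_chain2[OF DERIV_arctan this], of \<epsilon>]
    show "((\<lambda>y. arctan ((y - b) / \<epsilon>) / \<epsilon>) has_real_derivative 1 / (\<epsilon>\<^sup>2 + (y - b)\<^sup>2)) (at y)"
      unfolding eq .
    show "0 \<le> 1 / (\<epsilon>\<^sup>2 + (y - b)\<^sup>2)" using pos[of y] by simp
  qed (use assms in auto)
  also have "\<dots> \<le> ennreal (4 / \<epsilon>)"
  proof (rule ennreal_leI)
    have "arctan ((b + w - b) / \<epsilon>) \<le> 2" "- 2 \<le> arctan ((b - w - b) / \<epsilon>)"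
      using arctan_bounded[of "(b + w - b) / \<epsilon>"] arctan_bounded[of "(b - w - b) / \<epsilon>"] pi_less_4
      by (auto simp del: add_diff_cancel_left')
    then have "(arctan ((b + w - b) / \<epsilon>) - arctan ((b - w - b) / \<epsilon>)) / \<epsilon> \<le> 4 / \<epsilon>"
      using assms by (intro divide_right_mono) auto
    then show "arctan ((b + w - b) / \<epsilon>) / \<epsilon> - arctan ((b - w - b) / \<epsilon>) / \<epsilon> \<le> 4 / \<epsilon>"
      by (simp only: diff_divide_distrib)
  qed
  finally show ?thesis .
qed

lemma nn_integral_area_measure_finite:
  assumes [measurable]: "f \<in> borel_measurable lborel" and "(\<integral>\<^sup>+ z. f z \<partial>lborel) < \<infinity>"
  shows "(\<integral>\<^sup>+ z. f z \<partial>area_measure) < \<infinity>"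
proof -
  have "(\<integral>\<^sup>+ z. f z * indicator unit_disk z \<partial>lborel) \<le> (\<integral>\<^sup>+ z. f z \<partial>lborel)"
    by (intro nn_integral_mono) (auto split: split_indicator)
  then have "(\<integral>\<^sup>+ z. f z * indicator unit_disk z \<partial>lborel) < \<infinity>" using assms(2) by (rule le_less_trans)
  moreover have "emeasure lborel (unit_disk) \<noteq> 0"
    using content_ball_pos[of 1 "0::complex"] by (simp add: measure_def) (metis enn2real_0 less_irrefl)
  ultimately show ?thesis
    unfolding area_measure_def
    by (subst nn_integral_uniform_measure) (auto simp: less_top[symmetric] ennreal_divide_eq_top_iff)
qed

section \<open>Pointwise bounds\<close>

text \<open>
  The image of \<open>z \<mapsto> (1 + z) / 2\<close> is the disk with diameter \<open>[0, 1]\<close>. In the coordinate \<open>u = 1 -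
  Re z\<close> it is the region \<open>(Im z)\<^sup>2 < u - u\<^sup>2\<close>, which touches the unit circle at \<open>1\<close> only, and
  on it \<open>1 - |z|\<^sup>2\<close> is comparable to \<open>u\<close>.
\<close>

lemma image_disk_bounds:
  assumes "cmod (2 * z - 1) < 1"
  defines "u \<equiv> 1 - Re z"
  shows "0 < u" "u < 1" "(Im z)\<^sup>2 < u" "u \<le> 1 - (cmod z)\<^sup>2" "cmod z < 1"
    and "(cmod (2 * z - 1))\<^sup>2 \<ge> 1 - 4 * u"
proof -
  have eq: "(cmod (2 * z - 1))\<^sup>2 = 1 - 4 * u + 4 * u\<^sup>2 + 4 * (Im z)\<^sup>2"
    unfolding cmod_power2 u_def by (simp add: power2_eq_square algebra_simps)
  have "(cmod (2 * z - 1))\<^sup>2 < 1" using assms by (simp add: power_less_one_iff)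
  then have lt: "u\<^sup>2 + (Im z)\<^sup>2 < u" using eq by simp
  have sq: "0 \<le> u\<^sup>2" "0 \<le> (Im z)\<^sup>2" by auto
  show u: "0 < u" using lt sq by linarith
  have "u * u < 1 * u" using lt sq unfolding power2_eq_square by linarith
  then show "u < 1" using u by simp
  show "(Im z)\<^sup>2 < u" using lt sq by linarith
  have "1 - (cmod z)\<^sup>2 = 2 * u - (u\<^sup>2 + (Im z)\<^sup>2)"
    unfolding cmod_power2 u_def by (simp add: power2_eq_square algebra_simps)
  then show le: "u \<le> 1 - (cmod z)\<^sup>2" using lt by linarith
  then have "(cmod z)\<^sup>2 < 1" using u by linarith
  then show "cmod z < 1" by (simp add: power_less_one_iff)
  show "(cmod (2 * z - 1))\<^sup>2 \<ge> 1 - 4 * u" using eq sq by linarith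
qed

text \<open>
  The contribution of one factor to \<open>(1 - |\<theta>|\<^sup>2) / (1 - |z|\<^sup>2)\<close>.
\<close>

definition bl_kernel :: "nat \<Rightarrow> complex \<Rightarrow> real" where
  "bl_kernel n z = (1 - (cmod (bl_zero n))\<^sup>2) / (cmod (1 - cnj (bl_zero n) * z))\<^sup>2"

lemma bl_kernel_nonneg: "n \<ge> 1 \<Longrightarrow> 0 \<le> bl_kernel n z"
  using bl_zero_in_disk[of n] by (simp add: bl_kernel_def power_le_one)

lemma denominator_bounds:
  assumes "cmod (2 * z - 1) < 1" "n \<ge> 1"
  shows "(1 - Re z) / 2 \<le> cmod (1 - cnj (bl_zero n) * z)"
    and "\<bar>Im z - Im (bl_zero n)\<bar> \<le> cmod (1 - cnj (bl_zero n) * z)"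
    and "0 < cmod (1 - cnj (bl_zero n) * z)"
proof -
  note b = image_disk_bounds[OF assms(1)]
  have disk: "cmod (bl_zero n) \<le> 1" using bl_zero_in_disk[OF assms(2)] by simp
  have "1 - (cmod z)\<^sup>2 = (1 - cmod z) * (1 + cmod z)" by (simp add: power2_eq_square algebra_simps)
  also have "\<dots> \<le> (1 - cmod z) * 2" using b(5) by (intro mult_left_mono) auto
  finally have "(1 - Re z) / 2 \<le> 1 - cmod z" using b(4) by simp
  also have "\<dots> \<le> cmod (1 - cnj (bl_zero n) * z)"
    by (rule one_minus_le_cmod_one_minus_cnj_mult[OF disk])
  finally show u: "(1 - Re z) / 2 \<le> cmod (1 - cnj (bl_zero n) * z)" .
  have "0 < (1 - Re z) / 2" using b(1) by simp
  then show "0 < cmod (1 - cnj (bl_zero n) * z)" using u by (rule less_le_trans)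
  have "\<bar>Im z - Im (bl_zero n)\<bar> \<le> cmod (z - bl_zero n)" using abs_Im_le_cmod[of "z - bl_zero n"] by simp
  also have "\<dots> \<le> cmod (1 - cnj (bl_zero n) * z)"
    using b(5) disk by (intro cmod_diff_le_one_minus_cnj_mult) auto
  finally show "\<bar>Im z - Im (bl_zero n)\<bar> \<le> cmod (1 - cnj (bl_zero n) * z)" .
qed

text \<open>
  Horizontal strips around the zeros. The half-width \<open>2 ^ -n / 12\<close> is small enough for the
  strips to be disjoint and to lie above the height \<open>2 ^ -n / 2\<close>; the latter forces \<open>1 - Re z \<ge>
  4 ^ -n / 4\<close> for the points of the strip in the image disk.
\<close>

definition in_strip :: "nat \<Rightarrow> complex \<Rightarrow> bool" where
  "in_strip n z \<longleftrightarrow> \<bar>Im z - Im (bl_zero n)\<bar> \<le> 1 / 12 * (1 / 2 ^ n)"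

lemma in_strip_unique:
  assumes "in_strip n z" "in_strip m z" "n \<ge> 1" "m \<ge> 1"
  shows "n = m"
proof -
  have False if "in_strip n z" "in_strip m z" "1 \<le> n" "n < m" for n m
  proof -
    have "(2::real) ^ Suc n \<le> 2 ^ m" using that by (intro power_increasing) auto
    then have "(1 / 2 ^ m :: real) \<le> 1 / 2 * (1 / 2 ^ n)" by (simp add: field_simps)
    moreover have "0 < (1 / 2 ^ n :: real)" by simp
    ultimately show False
      using Im_bl_zero_gap[OF that(3,4)] that(1,2) unfolding in_strip_def by linarith
  qed
  then show ?thesis using assms by (metis linorder_neqE_nat)
qed

text \<open>
  Outside its strip the denominator of the \<open>n\<close>-th kernel is at least of the order of both \<open>1 -
  Re z\<close> and \<open>2 ^ -n\<close>. Interpolating between the two gives a bound that is summable in \<open>n\<close>, at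
  the price of a power of \<open>1 - Re z\<close> small enough to be integrable later.
\<close>

lemma bl_kernel_far:
  assumes z: "cmod (2 * z - 1) < 1" and n: "n \<ge> 1" and far: "\<not> in_strip n z"
  shows "bl_kernel n z \<le> 120 / sqrt (1 - Re z) * (3 / 4) ^ n"
proof -
  define D where "D = cmod (1 - cnj (bl_zero n) * z)"
  define s where "s = sqrt (1 / 2 ^ n)"
  define v where "v = sqrt (1 - Re z)"
  have u: "0 < 1 - Re z" by (rule image_disk_bounds[OF z])
  have s: "s > 0" "s\<^sup>2 = 1 / 2 ^ n" by (auto simp: s_def)
  have v: "v > 0" "v\<^sup>2 = 1 - Re z" using u by (auto simp: v_def)
  have D1: "v\<^sup>2 / 2 \<le> D" using denominator_bounds(1)[OF z n] by (simp add: v D_def)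
  have D2: "s\<^sup>2 / 12 \<le> D"
    using far denominator_bounds(2)[OF z n] by (simp add: in_strip_def s D_def)
  have "s * v / 5 \<le> D"
  proof -
    \<comment> \<open>the quadratic form \<open>v\<^sup>2 / 2 - 2 / 5 s v + s\<^sup>2 / 12\<close> is positive, as \<open>4 / 25 < 1 / 6\<close>\<close>
    have "0 \<le> (v - 2 / 5 * s)\<^sup>2" by simp
    then have "s * v * 4 / 5 \<le> v\<^sup>2 + 4 / 25 * s\<^sup>2"
      by (simp add: power2_eq_square algebra_simps)
    then have "s * v * 2 / 5 \<le> v\<^sup>2 / 2 + s\<^sup>2 / 12"
      using zero_le_power2[of s] by linarith
    then show ?thesis using D1 D2 by linarith
  qed
  then have "(s\<^sup>2 / 12) * (s * v / 5) \<le> D * D"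
    using D2 s v denominator_bounds(3)[OF z n] by (intro mult_mono) (auto simp: D_def)
  then have DD: "s ^ 3 * v / 60 \<le> D\<^sup>2" by (simp add: power2_eq_square power3_eq_cube mult_ac)
  have "1 - (cmod (bl_zero n))\<^sup>2 \<le> 2 * ((1 / 2 ^ n)\<^sup>2 / real n)" by (rule one_minus_bl_zero_square(2)[OF n])
  also have "\<dots> \<le> 2 * (s\<^sup>2)\<^sup>2" using n by (simp add: s divide_le_eq)
  finally have "bl_kernel n z \<le> 2 * (s\<^sup>2)\<^sup>2 / (s ^ 3 * v / 60)"
    unfolding bl_kernel_def D_def[symmetric] using DD s v by (intro frac_le) auto
  also have "\<dots> = 120 / v * s" using s v by (simp add: field_simps eval_nat_numeral)
  also have "120 / v * s \<le> 120 / v * (3 / 4) ^ n"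
  proof (rule mult_left_mono)
    have "s = sqrt (1 / 2) ^ n" by (simp add: s_def real_sqrt_power real_sqrt_divide power_divide)
    also have "\<dots> \<le> (3 / 4) ^ n" by (intro power_mono real_le_lsqrt) (auto simp: power2_eq_square)
    finally show "s \<le> (3 / 4) ^ n" .
  qed (use v in simp)
  finally show ?thesis by (simp add: v_def)
qed

lemma in_strip_lower:
  assumes z: "cmod (2 * z - 1) < 1" and n: "n \<ge> 1" and near: "in_strip n z"
  shows "(1 / 2 ^ n)\<^sup>2 / 4 \<le> 1 - Re z"
proof -
  define x :: real where "x = 1 / 2 ^ n"
  have x: "x > 0" by (simp add: x_def)
  have "13 / 20 * x - 1 / 12 * x \<le> Im z"
    using near Im_bl_zero_bounds(1)[OF n] unfolding in_strip_def x_def[symmetric] by linarith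
  then have "x / 2 \<le> Im z" using x by linarith
  then have "(x / 2)\<^sup>2 \<le> (Im z)\<^sup>2" using x by (intro power_mono) auto
  also have "\<dots> \<le> 1 - Re z" using image_disk_bounds(3)[OF z] by simp
  finally show ?thesis by (simp add: x_def power_divide)
qed

text \<open>
  Here \<open>D\<close>, the modulus of \<open>1 - cnj z\<^sub>n z\<close>, dominates \<open>1 - Re z\<close>, the distance in the imaginary
  direction, and \<open>4 ^ -n\<close>, up to constants. Of the power \<open>D ^ -5\<close> that is left, three factors
  are spent on \<open>1 - Re z\<close> and two on the imaginary part, so that the bound is a product of
  functions of the two coordinates.
\<close>

lemma bl_kernel_near:
  assumes z: "cmod (2 * z - 1) < 1" and n: "n \<ge> 1" and near: "in_strip n z"
  shows "(1 - Re z) * bl_kernel n z ^ 3 \<le> 256 * ((1 / 2 ^ n)\<^sup>2 / real n) ^ 3 *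
    (1 / (1 - Re z) ^ 3 * (1 / (((1 / 2 ^ n)\<^sup>2 / 8)\<^sup>2 + (Im z - Im (bl_zero n))\<^sup>2)))"
proof -
  define D where "D = cmod (1 - cnj (bl_zero n) * z)"
  define u where "u = 1 - Re z"
  define s where "s = Im z - Im (bl_zero n)"
  define \<epsilon> :: real where "\<epsilon> = (1 / 2 ^ n)\<^sup>2 / 8"
  define \<delta> where "\<delta> = (1 / 2 ^ n)\<^sup>2 / real n"
  have \<epsilon>: "\<epsilon> > 0" by (simp add: \<epsilon>_def)
  have \<delta>: "\<delta> > 0" using n by (simp add: \<delta>_def)
  have u: "u > 0" unfolding u_def by (rule image_disk_bounds[OF z])
  have D1: "u \<le> 2 * D" using denominator_bounds(1)[OF z n] by (simp add: u_def D_def)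
  have D: "D > 0" using D1 u by linarith
  have D2: "\<bar>s\<bar> \<le> D" using denominator_bounds(2)[OF z n] by (simp add: s_def D_def)
  have D3: "\<epsilon> \<le> D" using in_strip_lower[OF assms] D1 by (simp add: \<epsilon>_def u_def)
  have "\<epsilon>\<^sup>2 \<le> D\<^sup>2" "s\<^sup>2 \<le> D\<^sup>2"
    using D2 D3 \<epsilon> D by (auto intro!: power_mono simp: abs_le_square_iff[symmetric])
  then have Dsq: "\<epsilon>\<^sup>2 + s\<^sup>2 \<le> 2 * D\<^sup>2" by linarith
  have Dcube: "u ^ 3 \<le> 8 * D ^ 3" using power_mono[OF D1, of 3] u by (simp add: power_mult_distrib)
  have "bl_kernel n z \<le> 2 * \<delta> / D\<^sup>2"
    unfolding bl_kernel_def D_def[symmetric] \<delta>_def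
    using one_minus_bl_zero_square(2)[OF n] by (intro divide_right_mono) auto
  then have "bl_kernel n z ^ 3 \<le> (2 * \<delta> / D\<^sup>2) ^ 3"
    using bl_kernel_nonneg[OF n] by (intro power_mono) auto
  then have "u * bl_kernel n z ^ 3 \<le> (2 * D) * (2 * \<delta> / D\<^sup>2) ^ 3"
    using u D1 D \<delta> bl_kernel_nonneg[OF n, of z] by (intro mult_mono) auto
  also have "\<dots> = 256 * \<delta> ^ 3 * (1 / (8 * D ^ 3) * (1 / (2 * D\<^sup>2)))"
    using D by (simp add: field_simps eval_nat_numeral)
  also have "\<dots> \<le> 256 * \<delta> ^ 3 * (1 / u ^ 3 * (1 / (\<epsilon>\<^sup>2 + s\<^sup>2)))"
  proof -
    have "\<epsilon>\<^sup>2 + s\<^sup>2 > 0" using \<epsilon> by (intro add_pos_nonneg) auto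
    then show ?thesis
      using Dsq Dcube u \<delta> D by (intro mult_left_mono mult_mono frac_le) auto
  qed
  finally show ?thesis by (simp add: u_def s_def \<epsilon>_def \<delta>_def)
qed

lemma cube_add_le:
  fixes a b :: real
  assumes "0 \<le> a" "0 \<le> b"
  shows "(a + b) ^ 3 \<le> 4 * (a ^ 3 + b ^ 3)"
proof -
  have "0 \<le> 3 * (a + b) * (a - b)\<^sup>2" using assms by simp
  also have "\<dots> = 4 * (a ^ 3 + b ^ 3) - (a + b) ^ 3"
    by (simp add: power2_eq_square power3_eq_cube algebra_simps)
  finally show ?thesis by simp
qed

lemma nevanlinna_counting_half:
  assumes \<phi>: "\<And>z. z \<in> unit_disk \<Longrightarrow> \<phi> z = (1 + z) / 2"
  shows "nevanlinna_counting \<phi> w = (if cmod (2 * w - 1) < 1 then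
    if 2 * w - 1 = 0 then \<infinity> else ennreal (ln (1 / cmod (2 * w - 1))) else 0)"
proof -
  have "{\<zeta> \<in> unit_disk. \<phi> \<zeta> = w} = {\<zeta> \<in> unit_disk. \<zeta> = 2 * w - 1}"
  proof (intro Collect_cong conj_cong refl)
    fix \<zeta> :: complex assume "\<zeta> \<in> unit_disk"
    then show "\<phi> \<zeta> = w \<longleftrightarrow> \<zeta> = 2 * w - 1" by (subst \<phi>) (auto simp: field_simps)
  qed
  also have "\<dots> = (if cmod (2 * w - 1) < 1 then {2 * w - 1} else {})" by auto
  finally show ?thesis unfolding nevanlinna_counting_def by simp
qed

lemma ln_inverse_le:
  assumes "t > 0"
  shows "ln (1 / t) \<le> 2 / sqrt t"
proof -
  have "ln (1 / t) = 2 * ln (1 / sqrt t)" using assms by (simp add: ln_div ln_sqrt)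
  also have "\<dots> \<le> 2 * (1 / sqrt t - 1)" using assms by (intro mult_left_mono ln_le_minus_one) auto
  finally show ?thesis by simp
qed

text \<open>
  The logarithm cancels one factor \<open>1 / (1 - Re z)\<close> of the cubed quotient.
\<close>

lemma ln_near_boundary_le:
  assumes z: "cmod (2 * z - 1) < 1" and "1 / 2 \<le> cmod (2 * z - 1)"
  shows "ln (1 / cmod (2 * z - 1)) \<le> 8 * (1 - Re z)"
proof -
  define \<rho> where "\<rho> = cmod (2 * z - 1)"
  have \<rho>: "1 / 2 \<le> \<rho>" "\<rho> < 1" "1 - 4 * (1 - Re z) \<le> \<rho>\<^sup>2"
    using assms image_disk_bounds(6)[OF z] by (auto simp: \<rho>_def)
  have sq: "1 / 4 \<le> \<rho>\<^sup>2" "\<rho>\<^sup>2 \<le> 1"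
    using power_mono[OF \<rho>(1), of 2] \<rho> by (auto simp: power_le_one power_divide)
  have "2 * ln (1 / \<rho>) = ln (1 / \<rho>\<^sup>2)" using \<rho> by (simp add: ln_div ln_realpow)
  also have "\<dots> \<le> 1 / \<rho>\<^sup>2 - 1" using \<rho> by (intro ln_le_minus_one) auto
  also have "\<dots> = (1 - \<rho>\<^sup>2) / \<rho>\<^sup>2" using \<rho> by (auto simp: field_simps)
  also have "\<dots> \<le> (1 - \<rho>\<^sup>2) / (1 / 4)" using sq by (intro divide_left_mono) auto
  also have "\<dots> \<le> 16 * (1 - Re z)" using \<rho> by simp
  finally show ?thesis by (simp add: \<rho>_def)
qed

section \<open>Convergence of the integral\<close>

text \<open>
  By disjointness of the strips at most one kernel escapes the bound for points outside its
  strip. The remaining ones sum to \<open>120 \<cdot> 3\<close> times \<open>1 / sqrt (1 - Re z)\<close>, the \<open>3\<close> being the sum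
  of \<open>(3 / 4) ^ n\<close> over \<open>n \<ge> 1\<close>.
\<close>

lemma kernel_quotient_le:
  fixes z
  assumes bp: "blaschke_product (\<lambda>n. bl_zero (Suc n)) \<theta>" and z: "cmod (2 * z - 1) < 1"
  defines "K \<equiv> (1 - (cmod (\<theta> z))\<^sup>2) / (1 - (cmod z)\<^sup>2)"
  shows "K \<le> 1 / (1 - Re z)"
    and "\<exists>p\<ge>0. K \<le> p + 360 / sqrt (1 - Re z) \<and> (p = 0 \<or> (\<exists>n\<ge>1. in_strip n z \<and> p = bl_kernel n z))"
proof -
  note b = image_disk_bounds[OF z]
  show "K \<le> 1 / (1 - Re z)"
    unfolding K_def using b by (intro frac_le) auto
  define c where "c = 120 / sqrt (1 - Re z)"
  have c: "c \<ge> 0" using b(1) by (simp add: c_def)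
  have main: "K \<le> p + 360 / sqrt (1 - Re z)"
    if p: "0 \<le> p" and le: "\<And>i. bl_kernel (Suc i) z \<le> (if i = k then p else 0) + c * (3 / 4) ^ Suc i" for p k
  proof -
    have "(\<lambda>i. (c * (3 / 4)) * (3 / 4) ^ i) sums ((c * (3 / 4)) * (1 / (1 - 3 / 4)))"
      by (intro sums_mult geometric_sums) auto
    then have "(\<lambda>i. c * (3 / 4) ^ Suc i) sums (360 / sqrt (1 - Re z))"
      by (simp add: c_def mult.assoc)
    from sums_add[OF sums_single[of k "\<lambda>_. p"] this]
    have r: "(\<lambda>i. (if i = k then p else 0) + c * (3 / 4) ^ Suc i) sums (p + 360 / sqrt (1 - Re z))" .
    have summable: "summable (\<lambda>i. bl_kernel (Suc i) z)"
      by (rule summable_comparison_test'[OF sums_summable[OF r]]) (use le bl_kernel_nonneg in auto)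
    have "1 - (cmod (\<theta> z))\<^sup>2 \<le> (1 - (cmod z)\<^sup>2) * (\<Sum>i. bl_kernel (Suc i) z)"
      using blaschke_product.one_minus_theta_square_le[OF bp b(5)] summable by (simp add: bl_kernel_def)
    then have "K \<le> (\<Sum>i. bl_kernel (Suc i) z)"
      using b(1,4) by (simp add: K_def divide_le_eq mult.commute)
    also have "\<dots> \<le> p + 360 / sqrt (1 - Re z)"
      using suminf_le[OF le summable sums_summable[OF r]] r by (simp add: sums_iff)
    finally show ?thesis .
  qed
  show "\<exists>p\<ge>0. K \<le> p + 360 / sqrt (1 - Re z) \<and> (p = 0 \<or> (\<exists>n\<ge>1. in_strip n z \<and> p = bl_kernel n z))"
  proof (cases "\<exists>n\<ge>1. in_strip n z")
    case True
    then obtain n where n: "n \<ge> 1" "in_strip n z" by blast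
    have "bl_kernel (Suc i) z \<le> (if i = n - 1 then bl_kernel n z else 0) + c * (3 / 4) ^ Suc i" for i
    proof (cases "in_strip (Suc i) z")
      case True
      then have "Suc i = n" using in_strip_unique[of "Suc i" z n] n by simp
      moreover have "0 \<le> c * (3 / 4) ^ Suc i" using c by simp
      ultimately show ?thesis by auto
    next
      case False
      then show ?thesis
        using bl_kernel_far[OF z _ False] bl_kernel_nonneg[OF n(1), of z] unfolding c_def
        by (auto intro: add_increasing)
    qed
    then have "K \<le> bl_kernel n z + 360 / sqrt (1 - Re z)"
      by (rule main[OF bl_kernel_nonneg[OF n(1)]])
    then show ?thesis using n bl_kernel_nonneg[OF n(1)] by blast
  next
    case False
    have "K \<le> 0 + 360 / sqrt (1 - Re z)"
    proof (rule main[where k = 0])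
      show "bl_kernel (Suc i) z \<le> (if i = 0 then 0 else 0) + c * (3 / 4) ^ Suc i" for i
        using bl_kernel_far[OF z, of "Suc i"] False by (simp add: c_def del: power_Suc)
    qed simp
    then show ?thesis by auto
  qed
qed

text \<open>
  The three majorants cover the strips, the background left by the distant zeros, and the
  logarithmic pole at \<open>1 / 2\<close>. Each is a function of \<open>Re z\<close> times a function of \<open>Im z\<close>, so that
  its integral factorises.
\<close>

definition near_majorant :: "nat \<Rightarrow> complex \<Rightarrow> ennreal" where
  "near_majorant n z =
    (ennreal (8192 * ((1 / 2 ^ n)\<^sup>2 / real n) ^ 3) *
      (ennreal (1 / (1 - Re z) ^ 3) * indicator {0..1 - (1 / 2 ^ n)\<^sup>2 / 4} (Re z))) *
    (ennreal (1 / (((1 / 2 ^ n)\<^sup>2 / 8)\<^sup>2 + (Im z - Im (bl_zero n))\<^sup>2)) *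
      indicator {Im (bl_zero n) - 1 / 12 * (1 / 2 ^ n)..Im (bl_zero n) + 1 / 12 * (1 / 2 ^ n)} (Im z))"

definition far_majorant :: "complex \<Rightarrow> ennreal" where
  "far_majorant z = (ennreal (32 * 360 ^ 3) * inv_sqrt (1 + (- 1) * Re z)) * indicator {-1..1} (Im z)"

definition log_majorant :: "complex \<Rightarrow> ennreal" where
  "log_majorant z = (128 * (inv_sqrt (- 1 + 2 * Re z) + inv_sqrt (1 + (- 2) * Re z))) * indicator {-1..1} (Im z)"

lemma integrand_near_boundary_le:
  assumes bp: "blaschke_product (\<lambda>n. bl_zero (Suc n)) \<theta>"
    and z: "cmod (2 * z - 1) < 1" and ge: "1 / 2 \<le> cmod (2 * z - 1)"
  shows "ennreal (((1 - (cmod (\<theta> z))\<^sup>2) / (1 - (cmod z)\<^sup>2)) ^ 3) * ennreal (ln (1 / cmod (2 * z - 1)))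
    \<le> (\<Sum>i. near_majorant (Suc i) z) + far_majorant z"
proof -
  note b = image_disk_bounds[OF z]
  define K where "K = (1 - (cmod (\<theta> z))\<^sup>2) / (1 - (cmod z)\<^sup>2)"
  define u where "u = 1 - Re z"
  have u: "0 < u" "u < 1" using b by (auto simp: u_def)
  obtain p where p: "p \<ge> 0" "K \<le> p + 360 / sqrt u"
    "p = 0 \<or> (\<exists>n\<ge>1. in_strip n z \<and> p = bl_kernel n z)"
    using kernel_quotient_le(2)[OF bp z] unfolding K_def u_def by blast
  have "K ^ 3 \<le> (p + 360 / sqrt u) ^ 3" using p(2) by (intro power_mono_odd) auto
  also have "\<dots> \<le> 4 * (p ^ 3 + (360 / sqrt u) ^ 3)" using p(1) u by (intro cube_add_le) auto
  finally have "8 * u * K ^ 3 \<le> 8 * u * (4 * (p ^ 3 + (360 / sqrt u) ^ 3))"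
    using u by (intro mult_left_mono) auto
  also have "\<dots> = 32 * (u * p ^ 3) + 32 * 360 ^ 3 * (u / sqrt u ^ 3)"
    by (simp add: power_divide algebra_simps)
  also have "u / sqrt u ^ 3 = 1 / sqrt u"
  proof -
    have "sqrt u ^ 3 = u * sqrt u" using u by (simp add: power3_eq_cube)
    then show ?thesis using u by simp
  qed
  finally have cube: "8 * u * K ^ 3 \<le> 32 * (u * p ^ 3) + 32 * 360 ^ 3 * (1 / sqrt u)" .
  have "ennreal (K ^ 3) * ennreal (ln (1 / cmod (2 * z - 1))) \<le> ennreal (K ^ 3) * ennreal (8 * u)"
    using ln_near_boundary_le[OF z ge] by (intro mult_left_mono ennreal_leI) (auto simp: u_def)
  also have "\<dots> = ennreal (8 * u * K ^ 3)"
    using u by (subst ennreal_mult''[symmetric]) (auto simp: mult_ac)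
  also have "\<dots> \<le> ennreal (32 * (u * p ^ 3) + 32 * 360 ^ 3 * (1 / sqrt u))"
    by (rule ennreal_leI[OF cube])
  also have "\<dots> = ennreal (32 * (u * p ^ 3)) + ennreal (32 * 360 ^ 3 * (1 / sqrt u))"
    using u p(1) by (intro ennreal_plus) auto
  also have "ennreal (32 * 360 ^ 3 * (1 / sqrt u)) = far_majorant z"
  proof -
    have "\<bar>Im z\<bar> \<le> 1" using abs_Im_le_cmod[of z] b(5) by linarith
    then have "indicator {-1..1} (Im z) = (1 :: ennreal)" by (auto simp: abs_le_iff)
    then have "far_majorant z = ennreal (32 * 360 ^ 3) * inverse (ennreal (sqrt u))"
      using u by (simp add: far_majorant_def inv_sqrt_def u_def)
    also have "\<dots> = ennreal (32 * 360 ^ 3) * ennreal (1 / sqrt u)"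
      using u by (simp add: inverse_ennreal inverse_eq_divide)
    also have "\<dots> = ennreal (32 * 360 ^ 3 * (1 / sqrt u))"
      by (rule ennreal_mult'[symmetric]) simp
    finally show ?thesis by simp
  qed
  also have "ennreal (32 * (u * p ^ 3)) \<le> (\<Sum>i. near_majorant (Suc i) z)"
    using p(3)
  proof
    assume "\<exists>n\<ge>1. in_strip n z \<and> p = bl_kernel n z"
    then obtain n where n: "n \<ge> 1" "in_strip n z" "p = bl_kernel n z" by blast
    define X where "X = ((1 / 2 ^ n)\<^sup>2 / real n) ^ 3"
    define Y where "Y = 1 / (1 - Re z) ^ 3"
    define Z where "Z = 1 / (((1 / 2 ^ n)\<^sup>2 / 8)\<^sup>2 + (Im z - Im (bl_zero n))\<^sup>2)"
    have nonneg: "0 \<le> X" "0 \<le> Y" "0 \<le> Z" using u by (auto simp: X_def Y_def Z_def u_def)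
    have ind: "Re z \<in> {0..1 - (1 / 2 ^ n)\<^sup>2 / 4}"
      "Im z \<in> {Im (bl_zero n) - 1 / 12 * (1 / 2 ^ n)..Im (bl_zero n) + 1 / 12 * (1 / 2 ^ n)}"
      using in_strip_lower[OF z n(1,2)] u n(2) unfolding in_strip_def by (auto simp: u_def abs_le_iff)
    have "u * p ^ 3 \<le> 256 * X * (Y * Z)"
      using bl_kernel_near[OF z n(1,2)] by (simp only: u_def n(3) X_def Y_def Z_def)
    then have "ennreal (32 * (u * p ^ 3)) \<le> ennreal (8192 * X * Y * Z)" by (intro ennreal_leI) simp
    also have "\<dots> = near_majorant n z"
      unfolding near_majorant_def X_def[symmetric] Y_def[symmetric] Z_def[symmetric]
      using ind nonneg by (simp add: ennreal_mult)
    also have "\<dots> = (\<Sum>i\<in>{n - 1}. near_majorant (Suc i) z)" using n(1) by simp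
    also have "\<dots> \<le> (\<Sum>i. near_majorant (Suc i) z)" by (intro sum_le_suminf summableI) auto
    finally show ?thesis .
  qed simp
  finally show ?thesis by (simp add: K_def add_right_mono)
qed

lemma log_pole_le:
  assumes z: "cmod (2 * z - 1) < 1"
  shows "(if 2 * z - 1 = 0 then \<infinity> else ennreal (ln (1 / cmod (2 * z - 1))))
    \<le> 2 * (inv_sqrt (- 1 + 2 * Re z) + inv_sqrt (1 + (- 2) * Re z))"
proof -
  define t where "t = \<bar>2 * Re z - 1\<bar>"
  have t: "t \<le> cmod (2 * z - 1)" using abs_Re_le_cmod[of "2 * z - 1"] by (simp add: t_def)
  have inv: "inverse (ennreal (sqrt t)) \<le> inv_sqrt (- 1 + 2 * Re z) + inv_sqrt (1 + (- 2) * Re z)"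
  proof (cases "2 * Re z - 1 \<ge> 0")
    case True
    then have "inverse (ennreal (sqrt t)) = inv_sqrt (- 1 + 2 * Re z)"
      using t z by (auto simp: inv_sqrt_def t_def)
    then show ?thesis by simp
  next
    case False
    then have "inverse (ennreal (sqrt t)) = inv_sqrt (1 + (- 2) * Re z)"
      using t z by (auto simp: inv_sqrt_def t_def)
    then show ?thesis by simp
  qed
  have "(if 2 * z - 1 = 0 then \<infinity> else ennreal (ln (1 / cmod (2 * z - 1)))) \<le> 2 * inverse (ennreal (sqrt t))"
  proof (cases "t = 0")
    case True
    then show ?thesis by (simp add: ennreal_mult_top)
  next
    case False
    then have t0: "0 < t" by (simp add: t_def)
    have "ln (1 / cmod (2 * z - 1)) \<le> ln (1 / t)"
      using t t0 by (intro ln_mono) (auto intro!: frac_le)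
    also have "\<dots> \<le> 2 / sqrt t" by (rule ln_inverse_le[OF t0])
    finally have "ennreal (ln (1 / cmod (2 * z - 1))) \<le> ennreal (2 * inverse (sqrt t))"
      by (intro ennreal_leI) (simp add: divide_inverse)
    also have "\<dots> = 2 * inverse (ennreal (sqrt t))"
      using t0 by (simp add: ennreal_mult inverse_ennreal)
    finally show ?thesis using t t0 by auto
  qed
  also have "\<dots> \<le> 2 * (inv_sqrt (- 1 + 2 * Re z) + inv_sqrt (1 + (- 2) * Re z))"
    by (intro mult_left_mono inv) auto
  finally show ?thesis .
qed

lemma integrand_near_pole_le:
  assumes bp: "blaschke_product (\<lambda>n. bl_zero (Suc n)) \<theta>" and small: "cmod (2 * z - 1) < 1 / 2"
  shows "ennreal (((1 - (cmod (\<theta> z))\<^sup>2) / (1 - (cmod z)\<^sup>2)) ^ 3) *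
    (if 2 * z - 1 = 0 then \<infinity> else ennreal (ln (1 / cmod (2 * z - 1)))) \<le> log_majorant z"
proof -
  have z: "cmod (2 * z - 1) < 1" using small by simp
  note b = image_disk_bounds[OF z]
  define K where "K = (1 - (cmod (\<theta> z))\<^sup>2) / (1 - (cmod z)\<^sup>2)"
  have "\<bar>2 * Re z - 1\<bar> < 1 / 2" using abs_Re_le_cmod[of "2 * z - 1"] small by simp
  then have u: "1 / 4 \<le> 1 - Re z" by linarith
  have "K \<le> 1 / (1 - Re z)" unfolding K_def by (rule kernel_quotient_le(1)[OF bp z])
  also have "\<dots> \<le> 1 / (1 / 4)" using u by (intro frac_le) auto
  finally have "K ^ 3 \<le> 4 ^ 3" by (intro power_mono_odd) auto
  then have "ennreal (K ^ 3) \<le> ennreal 64" by (intro ennreal_leI) simp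
  then have "ennreal (K ^ 3) * (if 2 * z - 1 = 0 then \<infinity> else ennreal (ln (1 / cmod (2 * z - 1))))
    \<le> ennreal 64 * (2 * (inv_sqrt (- 1 + 2 * Re z) + inv_sqrt (1 + (- 2) * Re z)))"
    by (intro mult_mono log_pole_le z) auto
  also have "\<dots> = log_majorant z"
  proof -
    have "\<bar>Im z\<bar> \<le> 1" using abs_Im_le_cmod[of z] b(5) by linarith
    then have "indicator {-1..1} (Im z) = (1 :: ennreal)" by (auto simp: abs_le_iff)
    then show ?thesis by (simp add: log_majorant_def mult.assoc[symmetric])
  qed
  finally show ?thesis by (simp add: K_def)
qed

text \<open>
  The two one-dimensional integrals are of order \<open>16 ^ n\<close> and \<open>4 ^ n\<close>; they cancel \<open>4 ^ -(3 n)\<close>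
  in the constant factor exactly, leaving \<open>1 / n ^ 3\<close>. The exponent \<open>3\<close> of the quotient is what
  turns the harmonic series into a convergent one.
\<close>

lemma near_majorant_integral_le:
  assumes n: "n \<ge> 1"
  shows "(\<integral>\<^sup>+ z. near_majorant n z \<partial>lborel) \<le> ennreal (2097152 / real n ^ 2)"
proof -
  define x :: real where "x = 1 / 2 ^ n"
  have x: "x > 0" by (simp add: x_def)
  have "(\<integral>\<^sup>+ z. near_majorant n z \<partial>lborel) =
    (\<integral>\<^sup>+ t. ennreal (8192 * (x\<^sup>2 / real n) ^ 3) * (ennreal (1 / (1 - t) ^ 3) * indicator {0..1 - x\<^sup>2 / 4} t) \<partial>lborel) *
    (\<integral>\<^sup>+ y. ennreal (1 / ((x\<^sup>2 / 8)\<^sup>2 + (y - Im (bl_zero n))\<^sup>2)) *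
      indicator {Im (bl_zero n) - 1 / 12 * x..Im (bl_zero n) + 1 / 12 * x} y \<partial>lborel)"
    unfolding near_majorant_def x_def[symmetric]
    by (rule nn_integral_complex_product) auto
  also have "\<dots> \<le> (ennreal (8192 * (x\<^sup>2 / real n) ^ 3) * ennreal (1 / (2 * (x\<^sup>2 / 4)\<^sup>2))) * ennreal (4 / (x\<^sup>2 / 8))"
  proof (rule mult_mono)
    show "(\<integral>\<^sup>+ y. ennreal (1 / ((x\<^sup>2 / 8)\<^sup>2 + (y - Im (bl_zero n))\<^sup>2)) *
        indicator {Im (bl_zero n) - 1 / 12 * x..Im (bl_zero n) + 1 / 12 * x} y \<partial>lborel) \<le> ennreal (4 / (x\<^sup>2 / 8))"
      using x by (intro nn_integral_poisson) auto
    show "(\<integral>\<^sup>+ t. ennreal (8192 * (x\<^sup>2 / real n) ^ 3) *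
        (ennreal (1 / (1 - t) ^ 3) * indicator {0..1 - x\<^sup>2 / 4} t) \<partial>lborel)
        \<le> ennreal (8192 * (x\<^sup>2 / real n) ^ 3) * ennreal (1 / (2 * (x\<^sup>2 / 4)\<^sup>2))"
      using x by (subst nn_integral_cmult) (auto intro!: mult_left_mono nn_integral_inverse_cube)
  qed auto
  also have "\<dots> = ennreal (2097152 / real n ^ 3)"
    using x n by (simp add: ennreal_mult[symmetric] field_simps eval_nat_numeral)
  also have "\<dots> \<le> ennreal (2097152 / real n ^ 2)"
    using n by (intro ennreal_leI frac_le power_increasing) auto
  finally show ?thesis .
qed

lemma majorants_integrable:
  "(\<integral>\<^sup>+ z. (\<Sum>i. near_majorant (Suc i) z) + far_majorant z + log_majorant z \<partial>area_measure) < \<infinity>"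
proof (rule nn_integral_area_measure_finite)
  have m[measurable]: "near_majorant n \<in> borel_measurable borel" "far_majorant \<in> borel_measurable borel"
    "log_majorant \<in> borel_measurable borel" for n
    unfolding near_majorant_def[abs_def] far_majorant_def[abs_def] log_majorant_def[abs_def] by measurable
  show "(\<lambda>z. (\<Sum>i. near_majorant (Suc i) z) + far_majorant z + log_majorant z) \<in> borel_measurable lborel"
    by measurable
  have "(\<integral>\<^sup>+ z. (\<Sum>i. near_majorant (Suc i) z) \<partial>lborel) = (\<Sum>i. \<integral>\<^sup>+ z. near_majorant (Suc i) z \<partial>lborel)"
    by (rule nn_integral_suminf) measurable
  also have "\<dots> \<le> (\<Sum>i. ennreal (2097152 / real (Suc i) ^ 2))"
    by (intro suminf_le summableI near_majorant_integral_le) auto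
  also have "\<dots> = ennreal (\<Sum>i. 2097152 / real (Suc i) ^ 2)"
  proof (rule suminf_ennreal2)
    have "summable (\<lambda>i. 2097152 * inverse (real (Suc i) ^ 2))"
      by (intro summable_mult summable_Suc_iff[THEN iffD2] inverse_power_summable) auto
    then show "summable (\<lambda>i. 2097152 / real (Suc i) ^ 2)" by (simp add: divide_inverse)
  qed auto
  also have "\<dots> < \<infinity>" by simp
  finally have near: "(\<integral>\<^sup>+ z. (\<Sum>i. near_majorant (Suc i) z) \<partial>lborel) < \<infinity>" .
  have far: "(\<integral>\<^sup>+ z. far_majorant z \<partial>lborel) < \<infinity>"
    unfolding far_majorant_def using nn_integral_inv_sqrt_affine[of "- 1" 1]
    by (subst nn_integral_complex_product) (auto simp: nn_integral_cmult ennreal_mult_less_top)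
  have log: "(\<integral>\<^sup>+ z. log_majorant z \<partial>lborel) < \<infinity>"
    unfolding log_majorant_def
    using nn_integral_inv_sqrt_affine[of 2 "- 1"] nn_integral_inv_sqrt_affine[of "- 2" 1]
    by (subst nn_integral_complex_product)
      (auto simp: nn_integral_cmult nn_integral_add ennreal_mult_less_top)
  show "(\<integral>\<^sup>+ z. (\<Sum>i. near_majorant (Suc i) z) + far_majorant z + log_majorant z \<partial>lborel) < \<infinity>"
    using near far log by (simp add: nn_integral_add)
qed

lemma integral_finite:
  assumes bp: "blaschke_product (\<lambda>n. bl_zero (Suc n)) \<theta>"
    and \<phi>: "\<And>z. z \<in> unit_disk \<Longrightarrow> \<phi> z = (1 + z) / 2"
  shows "(\<integral>\<^sup>+ z. ennreal (((1 - (cmod (\<theta> z))\<^sup>2) / (1 - (cmod z)\<^sup>2)) ^ 3)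
    * nevanlinna_counting \<phi> z \<partial>area_measure) < \<infinity>"
proof -
  have "ennreal (((1 - (cmod (\<theta> z))\<^sup>2) / (1 - (cmod z)\<^sup>2)) ^ 3) * nevanlinna_counting \<phi> z
      \<le> (\<Sum>i. near_majorant (Suc i) z) + far_majorant z + log_majorant z" for z
  proof -
    have N: "nevanlinna_counting \<phi> z = (if cmod (2 * z - 1) < 1 then
        if 2 * z - 1 = 0 then \<infinity> else ennreal (ln (1 / cmod (2 * z - 1))) else 0)"
      using \<phi> by (rule nevanlinna_counting_half)
    consider "1 \<le> cmod (2 * z - 1)" | "cmod (2 * z - 1) < 1 / 2"
      | "1 / 2 \<le> cmod (2 * z - 1)" "cmod (2 * z - 1) < 1" by linarith
    then show ?thesis
    proof cases
      case 1
      then show ?thesis by (simp add: N)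
    next
      case 2
      have "ennreal (((1 - (cmod (\<theta> z))\<^sup>2) / (1 - (cmod z)\<^sup>2)) ^ 3) * nevanlinna_counting \<phi> z \<le> log_majorant z"
        using integrand_near_pole_le[OF bp 2] 2 unfolding N by simp
      also have "\<dots> \<le> (\<Sum>i. near_majorant (Suc i) z) + far_majorant z + log_majorant z"
        by (simp add: add_increasing)
      finally show ?thesis .
    next
      case 3
      then have "2 * z - 1 \<noteq> 0" by auto
      then have "ennreal (((1 - (cmod (\<theta> z))\<^sup>2) / (1 - (cmod z)\<^sup>2)) ^ 3) * nevanlinna_counting \<phi> z
          \<le> (\<Sum>i. near_majorant (Suc i) z) + far_majorant z"
        using integrand_near_boundary_le[OF bp 3(2,1)] 3 unfolding N by simp
      also have "\<dots> \<le> (\<Sum>i. near_majorant (Suc i) z) + far_majorant z + log_majorant z"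
        by (simp add: add_increasing2)
      finally show ?thesis .
    qed
  qed
  then have "(\<integral>\<^sup>+ z. ennreal (((1 - (cmod (\<theta> z))\<^sup>2) / (1 - (cmod z)\<^sup>2)) ^ 3) * nevanlinna_counting \<phi> z \<partial>area_measure)
      \<le> (\<integral>\<^sup>+ z. (\<Sum>i. near_majorant (Suc i) z) + far_majorant z + log_majorant z \<partial>area_measure)"
    by (intro nn_integral_mono)
  then show ?thesis using majorants_integrable by (rule le_less_trans)
qed

section \<open>The counterexample\<close>

theorem mainTheorem4:
  fixes \<alpha> r :: "nat \<Rightarrow> real" and zs :: "nat \<Rightarrow> complex" and \<theta> \<phi> :: "complex \<Rightarrow> complex"
  assumes "\<And>n. n \<ge> 1 \<Longrightarrow> \<alpha> n = 1 / 2 ^ n"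
    and "\<And>n. n \<ge> 1 \<Longrightarrow> r n = 1 - 1 / real n * (1 / 2 ^ (2 * n))"
    and "\<And>n. n \<ge> 1 \<Longrightarrow> zs n = of_real (r n) * exp (\<i> * of_real (\<alpha> n))"
    and "\<And>z. z \<in> unit_disk \<Longrightarrow> \<theta> z = (\<Prod>n. blaschke_factor (zs (Suc n)) z)"
    and "\<And>z. z \<in> unit_disk \<Longrightarrow> \<phi> z = (1 + z) / 2"
  shows "(\<integral>\<^sup>+ z. ennreal (((1 - (cmod (\<theta> z))\<^sup>2) / (1 - (cmod z)\<^sup>2)) ^ 3)
            * nevanlinna_counting \<phi> z \<partial>area_measure) < \<infinity>
    \<and> bounded_h2_operator (model_space \<theta>) (composition_op \<phi>)
    \<and> \<not> hilbert_schmidt_h2 (model_space \<theta>) (composition_op \<phi>)"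
proof -
  have zs: "zs (Suc n) = bl_zero (Suc n)" for n
    using assms(1-3)[of "Suc n"] by (simp only: bl_zero_def bl_radius_def)
  have bp: "blaschke_product (\<lambda>n. bl_zero (Suc n)) \<theta>"
  proof
    fix n
    show "cmod (bl_zero (Suc n)) < 1" by (rule bl_zero_in_disk) simp
    show "bl_zero (Suc n) \<noteq> 0"
      using cmod_bl_zero[of "Suc n"] bl_radius_bounds(1)[of "Suc n"] by auto
    show "\<theta> z = (\<Prod>n. blaschke_factor (bl_zero (Suc n)) z)" if "cmod z < 1" for z
      using assms(4)[of z] that by (simp add: zs)
  next
    show "summable (\<lambda>n. 1 - cmod (bl_zero (Suc n)))"
    proof (rule summable_comparison_test')
      show "summable (\<lambda>n. (1 / 2 :: real) ^ n)" by (rule summable_geometric) simp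
      fix n
      have "1 - cmod (bl_zero (Suc n)) = (1 / 2 ^ Suc n)\<^sup>2 / real (Suc n)"
        by (simp add: cmod_bl_zero bl_radius_altdef)
      also have "\<dots> \<le> (1 / 2 ^ Suc n)\<^sup>2 / 1" by (intro divide_left_mono) auto
      also have "\<dots> = (1 / 2) ^ (2 * Suc n)" by (simp only: div_by_1 power_one_over power_even_eq)
      also have "\<dots> \<le> (1 / 2) ^ n" by (rule power_decreasing) auto
      finally show "norm (1 - cmod (bl_zero (Suc n))) \<le> (1 / 2) ^ n"
        using bl_zero_in_disk[of "Suc n"] by simp
    qed
  qed
  interpret blaschke_product "\<lambda>n. bl_zero (Suc n)" \<theta> by (rule bp)
  have zeros: "\<theta> (bl_zero n) = 0" if "n \<ge> 1" for n
    using theta_zero[of "n - 1"] that by simp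
  have "bounded_h2_operator (model_space \<theta>) (composition_op \<phi>)"
    unfolding bounded_h2_operator_def
  proof (intro conjI ballI allI exI[of _ "sqrt 2"])
    fix f assume "f \<in> model_space \<theta>"
    then have f: "f \<in> hardy2" by (rule model_space_hardy2)
    show "composition_op \<phi> f \<in> hardy2"
      using assms(5) f by (rule composition_op_half_hardy2)
    show "h2_norm (composition_op \<phi> f) \<le> sqrt 2 * h2_norm f"
      using assms(5) f by (rule composition_op_half_bounded)
  qed (simp add: composition_op_def)
  moreover have "\<not> hilbert_schmidt_h2 (model_space \<theta>) (composition_op \<phi>)"
    using assms(5) theta_holomorphic zeros by (rule composition_op_half_not_hilbert_schmidt)
  ultimately show ?thesis using integral_finite[OF bp assms(5)] by blast
qed

end
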